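(* Let $\eta$ be a positive real function on $[2,\infty)$ and let $\mathcal{A}=\{a_n\}_{n\ge1}$ be a strictly increasing sequence of positive integers such that, for some constants $K_1,\dots,K_4>0$ and all $x\ge 2$: $K_1 x/\eta(x)\le\mathcal{A}(x)\le K_2 x/\eta(x)$, $\mathcal{A}(x/2)\ge K_3\mathcal{A}(x)$, and $\mathcal{A}(x,r)\le K_4\frac{r}{\varphi(r)}\frac{x}{\eta(x)^2}$ for every positive integer $r$. Let $a\ge2$ be an integer and $f(n)=\gamma_d n^d+\dots+\gamma_0$ a polynomial with integer coefficients, $\gamma_d>0$, $\gcd(\gamma_d,\dots,\gamma_0)=1$, and $f(\mathbb{N})\subseteq\mathbb{N}$. Let $r(n)=\#\{(k,p)\in\mathbb{N}\times\mathbb{P}: a_k+a^{f(p)}=n\}$. Then there exist positive constants $x_0,c_1,c_2$ depending only on $a$, $f$ and $K_1,\dots,K_4$ such that for all $x\ge x_0$, \[ \#\Big\{n\le x: r(n)\ge c_1\frac{(\log x)^{1/d}}{\eta(x)\log\log x}\Big\}\ge c_2\,x\,\frac{(\log x)^{1/d}}{(\log x)^{1/d}+\eta(x)\log\log x}. \]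
   Context: $\mathbb{P}$ is the set of primes. $\mathcal{A}(x)=\#\{n: a_n\le x\}$, $\mathcal{A}(x,r)=\#\{n: a_n\le x,\ a_n+r\in\mathcal{A}\}$; $\varphi$ is Euler's totient function. *)

theory Defs
  imports "HOL-Number_Theory.Number_Theory" "HOL-Computational_Algebra.Computational_Algebra"
begin

(* A sequence (a_n) with n \<ge> 1 is a function A :: nat \<Rightarrow> nat whose value at 0 is never used.
   Accordingly the set of natural numbers of the source is the set of positive integers. *)

definition pos_strict_seq :: "(nat \<Rightarrow> nat) \<Rightarrow> bool" where
  "pos_strict_seq A \<longleftrightarrow> (\<forall>n\<ge>1. A n > 0) \<and> strict_mono_on {1..} A"

definition seq_count :: "(nat \<Rightarrow> nat) \<Rightarrow> real \<Rightarrow> nat" where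
  "seq_count A x = card {n. n \<ge> 1 \<and> real (A n) \<le> x}"

definition shift_count :: "(nat \<Rightarrow> nat) \<Rightarrow> real \<Rightarrow> nat \<Rightarrow> nat" where
  "shift_count A x r = card {n. n \<ge> 1 \<and> real (A n) \<le> x \<and> A n + r \<in> A ` {1..}}"

(* The exponent is converted by nat, which loses nothing for an f that is positive on the
   positive integers.  If moreover a \<ge> 2, f is nonconstant and A is strictly increasing, the set
   counted is finite, so card is its true cardinality. *)
definition rep_count :: "nat \<Rightarrow> int poly \<Rightarrow> (nat \<Rightarrow> nat) \<Rightarrow> nat \<Rightarrow> nat" where
  "rep_count a f A n =
     card {(k, p). k \<ge> 1 \<and> prime p \<and> A k + a ^ nat (poly f (int p)) = n}"

definition admissible :: "real \<Rightarrow> real \<Rightarrow> real \<Rightarrow> real \<Rightarrow> (real \<Rightarrow> real) \<Rightarrow> (nat \<Rightarrow> nat) \<Rightarrow> bool" where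
  "admissible K1 K2 K3 K4 \<eta> A \<longleftrightarrow>
     (\<forall>x\<ge>2. K1 * x / \<eta> x \<le> real (seq_count A x) \<and> real (seq_count A x) \<le> K2 * x / \<eta> x) \<and>
     (\<forall>x\<ge>2. real (seq_count A (x / 2)) \<ge> K3 * real (seq_count A x)) \<and>
     (\<forall>x\<ge>2. \<forall>r\<ge>1. real (shift_count A x r)
        \<le> K4 * (real r / real (totient r)) * (x / (\<eta> x)\<^sup>2))"

end

theory Submission
  imports Defs "HOL-Analysis.Convex"
begin

text \<open>
  Let \<open>S\<close> be the set of primes up to \<open>P\<close>, where \<open>P\<close> is of order \<open>(ln x) powr (1 / d)\<close> and
  \<open>a ^ f p \<le> x / 2\<close> on \<open>S\<close>. Restricting to \<open>a_k \<le> x / 2\<close> and \<open>p \<in> S\<close>, the representation numbers have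
  average of order \<open>card S / \<eta> x\<close>, and the theorem follows from Cauchy-Schwarz and a bound for their
  second moment. By the hypothesis on shifts, this bound reduces to showing that \<open>m / \<phi> m\<close>, with
  \<open>m = a ^ (f p - f q) - 1\<close>, is bounded on average over pairs in \<open>S\<close>.

  As in Romanoff's theorem, \<open>m / \<phi> m\<close> is the sum of \<open>1 / \<phi> k\<close> over squarefree \<open>k\<close> dividing \<open>m\<close>, and \<open>k\<close>
  divides \<open>m\<close> iff the order \<open>e\<close> of \<open>a\<close> modulo \<open>k\<close> divides \<open>f p - f q\<close>. For fixed \<open>p\<close>, the share of such
  \<open>q \<in> S\<close> is at most a constant times \<open>e powr - \<delta>\<close>: the congruence has few solutions modulo \<open>e\<close>, and
  for small \<open>e\<close> a Chebyshev bound controls the primes in each residue class, with a loss of \<open>ln e\<close>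
  that the saving absorbs. The sum of \<open>1 / \<phi> k\<close> against \<open>e powr - \<delta>\<close> converges because
  \<open>n / \<phi> n\<close> grows slower than any power of \<open>ln n\<close>.
\<close>

section \<open>The ratio of an integer to its totient\<close>

lemma prod_one_plus_Pow:
  fixes g :: "'b \<Rightarrow> 'a::comm_semiring_1"
  assumes "finite S"
  shows "(\<Prod>q\<in>S. 1 + g q) = (\<Sum>T\<in>Pow S. \<Prod>q\<in>T. g q)"
  using assms
proof (induction S rule: finite_induct)
  case (insert x S)
  have "(\<Sum>T\<in>Pow (insert x S). prod g T) = (\<Sum>T\<in>Pow S. prod g T) + (\<Sum>T\<in>insert x ` Pow S. prod g T)"
    unfolding Pow_insert using insert by (intro sum.union_disjoint) auto
  also have "(\<Sum>T\<in>insert x ` Pow S. prod g T) = (\<Sum>T\<in>Pow S. prod g (insert x T))"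
    using insert by (intro sum.reindex_cong[where l="insert x"]) (auto simp: inj_on_def)
  also have "\<dots> = (\<Sum>T\<in>Pow S. g x * prod g T)"
    using insert by (intro sum.cong refl prod.insert) (auto intro: finite_subset)
  finally show ?case using insert by (simp add: sum_distrib_left sum.distrib distrib_right)
qed simp

text \<open>The factor is q / (q - 1), written so that multiplying out gives one term for each
  squarefree divisor.\<close>

definition totient_ratio :: "nat \<Rightarrow> real" where
  "totient_ratio n = (\<Prod>q\<in>prime_factors n. 1 + 1 / (real q - 1))"

lemma divide_totient:
  assumes "n > 0"
  shows "real n / real (totient n) = totient_ratio n"
proof -
  have "real (totient n) = real n * (\<Prod>p\<in>prime_factors n. 1 - 1 / real p)"
    by (rule totient_formula2)
  then have "real n / real (totient n) = inverse (\<Prod>p\<in>prime_factors n. 1 - 1 / real p)"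
    using assms by (simp add: field_simps)
  also have "\<dots> = (\<Prod>p\<in>prime_factors n. inverse (1 - 1 / real p))"
    by (simp add: prod_inversef[symmetric] comp_def)
  also have "\<dots> = totient_ratio n"
    unfolding totient_ratio_def
  proof (intro prod.cong refl)
    fix p assume "p \<in> prime_factors n"
    then have "p > 1" using prime_gt_1_nat[of p] by (simp add: in_prime_factors_iff)
    then have "real p > 1" by simp
    then show "inverse (1 - 1 / real p) = 1 + 1 / (real p - 1)"
      by (simp add: field_simps)
  qed
  finally show ?thesis .
qed

text \<open>For a set \<open>T\<close> of primes this is 1 / \<phi> (\<Prod>T). Encoding squarefree
  numbers by their sets of primes turns divisor sums into sums over a power set.\<close>

definition totient_weight :: "nat set \<Rightarrow> real" where
  "totient_weight T = (\<Prod>q\<in>T. 1 / (real q - 1))"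

lemma totient_ratio_eq_sum: "totient_ratio n = (\<Sum>T\<in>Pow (prime_factors n). totient_weight T)"
  unfolding totient_ratio_def totient_weight_def by (rule prod_one_plus_Pow) simp

lemma totient_weight_nonneg:
  assumes "\<And>q. q \<in> T \<Longrightarrow> prime q"
  shows "totient_weight T \<ge> 0"
  unfolding totient_weight_def
  by (intro prod_nonneg) (use assms prime_ge_1_nat in fastforce)

text \<open>A prime dividing both \<open>m\<close> and \<open>n\<close> is counted once on the left
  and twice on the right, and every factor is at least 1.\<close>

lemma totient_ratio_mult_le: "totient_ratio (m * n) \<le> totient_ratio m * totient_ratio n"
proof (cases "m = 0 \<or> n = 0")
  case True
  have ge: "totient_ratio k \<ge> 1" for k
    unfolding totient_ratio_def
    by (intro prod_ge_1) (auto simp: in_prime_factors_iff dest!: prime_gt_1_nat)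
  show ?thesis
  proof -
    have "totient_ratio (m*n) = 1" using True by (auto simp: totient_ratio_def)
    also have "1 \<le> totient_ratio m * totient_ratio n"
      using ge[of m] ge[of n] by (metis mult_mono' mult_1 zero_le_one)
    finally show ?thesis .
  qed
next
  case False
  let ?g = "\<lambda>q. 1 + 1 / (real q - 1)"
  have ge1: "?g q \<ge> 1" if "q \<in> prime_factors k" for q k
    using that by (auto simp: in_prime_factors_iff dest!: prime_gt_1_nat)
  have eq: "prime_factors (m * n) = prime_factors m \<union> (prime_factors n - prime_factors m)"
    using False by (auto simp: prime_factors_product)
  have "totient_ratio (m * n) = totient_ratio m * prod ?g (prime_factors n - prime_factors m)"
    unfolding totient_ratio_def eq by (rule prod.union_disjoint) auto
  also have "prod ?g (prime_factors n - prime_factors m) \<le> totient_ratio n"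
    unfolding totient_ratio_def
    by (rule prod_mono2) (use ge1 in \<open>force+\<close>)
  finally show ?thesis
    using prod_nonneg[of "prime_factors m" ?g] ge1 unfolding totient_ratio_def
    by (smt (verit) mult_left_mono)
qed

lemma totient_ratio_power_le: "totient_ratio (a ^ k) \<le> totient_ratio a"
proof (cases "k = 0")
  case True
  then show ?thesis
    unfolding totient_ratio_def
    by (auto intro!: prod_ge_1 simp: in_prime_factors_iff dest!: prime_gt_1_nat)
next
  case False
  then show ?thesis by (simp add: totient_ratio_def prime_factors_power)
qed

lemma totient_ratio_pos: "totient_ratio n > 0"
  unfolding totient_ratio_def
  by (intro prod_pos) (auto simp: in_prime_factors_iff dest!: prime_gt_1_nat intro!: add_pos_pos)

section \<open>Mertens' bound and the growth of the ratio\<close>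

lemma prime_power_dvd_fact:
  fixes p :: nat
  assumes "k * p \<le> n" "p > 0"
  shows "p ^ k dvd fact n"
  using assms
proof (induction k arbitrary: n)
  case (Suc k)
  let ?m = "Suc k * p"
  have "p ^ k dvd fact (?m - 1)" using Suc by (intro Suc.IH) (auto simp: algebra_simps)
  moreover have "p dvd ?m" by simp
  moreover have "(fact ?m :: nat) = ?m * fact (?m - 1)"
    using Suc.prems fact_reduce[of ?m, where 'a=nat] by simp
  ultimately have "p * p ^ k dvd fact ?m" by (metis mult_dvd_mono)
  also have "(fact ?m :: nat) dvd fact n" using Suc.prems fact_dvd[of ?m n, where 'a=nat] by simp
  finally show ?case by simp
qed simp

text \<open>One half of Mertens' first theorem, with a crude constant: the product of
  \<open>p ^ (n div p)\<close> divides \<open>fact n\<close>, which is at most \<open>n ^ n\<close>.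
  Rounding n / p down costs at most a factor 2, since \<open>p \<le> n\<close>.\<close>

lemma sum_log_prime_div_prime_le:
  assumes "n > 0"
  shows "(\<Sum>p | prime p \<and> p \<le> n. ln (real p) / real p) \<le> 2 * ln (real n)"
proof -
  let ?S = "{p::nat. prime p \<and> p \<le> n}"
  have fin: "finite ?S" by simp
  have "(\<Prod>p\<in>T. p ^ (n div p)) dvd fact n" if "T \<subseteq> ?S" for T
  proof -
    have "finite T" using that fin by (rule finite_subset)
    then show ?thesis using that
    proof (induction T rule: finite_induct)
      case (insert p T)
      have "coprime (p ^ (n div p)) (\<Prod>p\<in>T. p ^ (n div p))"
        using insert by (intro prod_coprime_right) (auto intro!: primes_coprime)
      moreover have "p ^ (n div p) dvd fact n"
        using insert by (intro prime_power_dvd_fact) (auto simp: prime_gt_0_nat)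
      ultimately show ?case using insert by (auto intro: divides_mult)
    qed simp
  qed
  from this[OF order_refl] have "(\<Prod>p\<in>?S. p ^ (n div p)) \<le> fact n" by (intro dvd_imp_le) auto
  also have "\<dots> \<le> n ^ n" using fact_le_power[of n, where 'a=nat] by simp
  finally have "real (\<Prod>p\<in>?S. p ^ (n div p)) \<le> real (n ^ n)" by (simp only: of_nat_le_iff)
  then have "ln (\<Prod>p\<in>?S. real p ^ (n div p)) \<le> ln (real n ^ n)"
    using assms by (subst ln_le_cancel_iff) (auto intro!: prod_pos simp: prime_gt_0_nat)
  also have "ln (\<Prod>p\<in>?S. real p ^ (n div p)) = (\<Sum>p\<in>?S. ln (real p ^ (n div p)))"
    using fin by (intro ln_prod) (auto simp: prime_gt_0_nat)
  also have "\<dots> = (\<Sum>p\<in>?S. real (n div p) * ln (real p))"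
    by (intro sum.cong refl) (auto simp: ln_realpow prime_gt_0_nat)
  also have "ln (real n ^ n) = real n * ln (real n)" using assms by (simp add: ln_realpow)
  finally have le: "(\<Sum>p\<in>?S. real (n div p) * ln (real p)) \<le> real n * ln (real n)" .
  have "real n / 2 * (\<Sum>p\<in>?S. ln (real p) / real p) \<le> (\<Sum>p\<in>?S. real (n div p) * ln (real p))"
    unfolding sum_distrib_left
  proof (intro sum_mono)
    fix p assume p: "p \<in> ?S"
    then have "p > 0" by (auto simp: prime_gt_0_nat)
    have "1 \<le> n div p" using p \<open>p > 0\<close> by (simp add: div_greater_zero_iff Suc_le_eq)
    then have "p \<le> n div p * p" by simp
    moreover have "n = n div p * p + n mod p" by simp
    moreover have "n mod p < p" using \<open>p > 0\<close> by simp
    ultimately have "n \<le> 2 * (n div p * p)" by linarith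
    then have "n \<le> 2 * (n div p) * p" by (simp only: mult.assoc)
    then have "real n \<le> 2 * real (n div p) * real p" by (metis of_nat_le_iff of_nat_mult of_nat_numeral)
    then have "real n / 2 / real p \<le> real (n div p)" using \<open>p > 0\<close> by (simp add: field_simps)
    moreover have "ln (real p) \<ge> 0" using \<open>p > 0\<close> by simp
    ultimately have "real n / 2 / real p * ln (real p) \<le> real (n div p) * ln (real p)" by (intro mult_right_mono)
    then show "real n / 2 * (ln (real p) / real p) \<le> real (n div p) * ln (real p)" by simp
  qed
  with le have "real n * (\<Sum>p\<in>?S. ln (real p) / real p) \<le> real n * (2 * ln (real n))" by simp
  then show ?thesis using assms by (simp only: mult_le_cancel_left_pos of_nat_0_less_iff)
qed

lemma card_prime_factors_le:
  fixes n :: nat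
  assumes "n > 0" "n \<le> 2 ^ y"
  shows "card (prime_factors n) \<le> y"
proof -
  have "(2::nat) ^ card (prime_factors n) = (\<Prod>q\<in>prime_factors n. 2)" by simp
  also have "(\<Prod>q\<in>prime_factors n. 2) \<le> (\<Prod>q\<in>prime_factors n. q)" by (intro prod_mono) (auto simp: in_prime_factors_iff prime_ge_2_nat)
  also have "\<dots> \<le> (\<Prod>q\<in>prime_factors n. q ^ multiplicity q n)"
    by (intro prod_mono conjI self_le_power) (auto simp: prime_factors_multiplicity prime_gt_0_nat prime_ge_1_nat Suc_le_eq)
  also have "\<dots> = n" using assms prime_factorization_nat by simp
  finally have "(2::nat) ^ card (prime_factors n) \<le> 2 ^ y" using assms by linarith
  then show ?thesis by simp
qed

text \<open>Here \<open>y\<close> bounds the binary logarithm of \<open>n\<close>. The reciprocals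
  of the primes dividing \<open>n\<close> are summed in three ranges: those up to a constant
  \<open>z\<close> contribute a constant, those between \<open>z\<close> and \<open>y\<close> are
  controlled by Mertens' bound, and those above \<open>y\<close> contribute at most 1, because
  \<open>n\<close> has at most \<open>y\<close> prime factors.\<close>

lemma totient_ratio_le_powr:
  assumes "\<epsilon> > 0"
  obtains C where "C > 0" "\<And>n y. 1 \<le> y \<Longrightarrow> 0 < n \<Longrightarrow> n \<le> 2 ^ y \<Longrightarrow> totient_ratio n \<le> C * real y powr \<epsilon>"
proof
  \<comment> \<open>For \<open>q > z\<close> this gives 1 / q \<le> (\<epsilon> / 4) (ln q / q), so
    the middle range sums to at most (\<epsilon> / 2) ln y. Passing from 1 / (q - 1) to 2 / q
    doubles this to \<epsilon> ln y.\<close>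
  define z :: nat where "z = nat \<lceil>exp (4 / \<epsilon>)\<rceil>"
  have z: "real z \<ge> exp (4 / \<epsilon>)" unfolding z_def by linarith
  have "exp (4/\<epsilon>) > 1" using assms by simp
  then have z1: "z > 1" using z by linarith
  have lnz: "ln (real z) \<ge> 4 / \<epsilon>" using z z1 by (simp add: ln_ge_iff)
  show "exp (2 * real z + 2) > 0" by simp
  fix n y :: nat assume y: "1 \<le> y" and n: "0 < n" "n \<le> 2 ^ y"
  let ?PF = "prime_factors n"
  have pr: "prime q" "q > 0" "real q \<ge> 2" if "q \<in> ?PF" for q
    using that prime_ge_2_nat[of q] by (auto simp: in_prime_factors_iff prime_gt_0_nat)
  let ?A = "{q\<in>?PF. q \<le> z}" and ?B = "{q\<in>?PF. z < q \<and> q \<le> y}" and ?D = "{q\<in>?PF. z < q \<and> y < q}"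
  have "(\<Sum>q\<in>?PF. 1 / real q) = (\<Sum>q\<in>?A \<union> (?B \<union> ?D). 1 / real q)"
    by (intro sum.cong) auto
  also have "\<dots> = (\<Sum>q\<in>?A. 1 / real q) + ((\<Sum>q\<in>?B. 1 / real q) + (\<Sum>q\<in>?D. 1 / real q))"
    by (subst sum.union_disjoint; (subst sum.union_disjoint)?) auto
  also have "(\<Sum>q\<in>?A. 1 / real q) \<le> (\<Sum>q\<in>?A. 1)"
    by (intro sum_mono) (use pr(3) in \<open>force simp: divide_le_eq_1\<close>)
  also have "(\<Sum>q\<in>?A. 1 :: real) \<le> real z"
  proof -
    have "card ?A \<le> card {1..z}" by (intro card_mono) (use pr in \<open>auto simp: Suc_le_eq\<close>)
    then show ?thesis by simp
  qed
  also have "(\<Sum>q\<in>?D. 1 / real q) \<le> (\<Sum>q\<in>?D. 1 / real y)"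
    by (intro sum_mono frac_le) (use y in auto)
  also have "\<dots> \<le> 1"
  proof -
    have "card ?D \<le> card ?PF" by (intro card_mono) auto
    also have "\<dots> \<le> y" using n by (rule card_prime_factors_le)
    finally show ?thesis using y by simp
  qed
  also have "(\<Sum>q\<in>?B. 1 / real q) \<le> \<epsilon> / 2 * ln (real y)"
  proof -
    have "(\<Sum>q\<in>?B. 1 / real q) \<le> (\<Sum>q\<in>?B. \<epsilon> / 4 * (ln (real q) / real q))"
    proof (intro sum_mono)
      fix q assume q: "q \<in> ?B"
      have "4 / \<epsilon> \<le> ln (real q)" using q z1 by (intro order_trans[OF lnz]) auto
      then have "1 \<le> \<epsilon> / 4 * ln (real q)" using assms by (simp add: field_simps)
      then show "1 / real q \<le> \<epsilon> / 4 * (ln (real q) / real q)"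
        using pr[of q] q by (auto simp: divide_simps)
    qed
    also have "\<dots> = \<epsilon> / 4 * (\<Sum>q\<in>?B. ln (real q) / real q)" by (rule sum_distrib_left[symmetric])
    also have "(\<Sum>q\<in>?B. ln (real q) / real q) \<le> (\<Sum>q | prime q \<and> q \<le> y. ln (real q) / real q)"
      by (intro sum_mono2) (use pr in \<open>auto dest!: prime_gt_0_nat\<close>)
    also have "\<dots> \<le> 2 * ln (real y)" by (rule sum_log_prime_div_prime_le) (use y in auto)
    finally show ?thesis using assms by (simp add: mult_left_mono)
  qed
  finally have S: "(\<Sum>q\<in>?PF. 1 / real q) \<le> real z + (\<epsilon> / 2 * ln (real y) + 1)" by simp
  have "totient_ratio n \<le> (\<Prod>q\<in>?PF. exp (2 * (1 / real q)))"
    unfolding totient_ratio_def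
  proof (intro prod_mono conjI)
    fix q assume q: "q \<in> ?PF"
    then show "0 \<le> 1 + 1 / (real q - 1)" using pr(3)[OF q] by simp
    have "1 / (real q - 1) \<le> 2 * (1 / real q)" using pr(3)[OF q] by (simp add: divide_simps)
    then show "1 + 1 / (real q - 1) \<le> exp (2 * (1 / real q))"
      using exp_ge_add_one_self[of "2 * (1 / real q)"] by linarith
  qed
  also have "\<dots> = exp (2 * (\<Sum>q\<in>?PF. 1 / real q))"
    by (simp add: exp_sum sum_distrib_left)
  also have "\<dots> \<le> exp (2 * (real z + (\<epsilon> / 2 * ln (real y) + 1)))" using S by simp
  also have "\<dots> = exp (2 * real z + 2) * real y powr \<epsilon>"
    using y by (simp add: powr_def exp_add[symmetric] algebra_simps)
  finally show "totient_ratio n \<le> exp (2 * real z + 2) * real y powr \<epsilon>" .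
qed

section \<open>Romanoff's series\<close>

text \<open>Its prime factors are the primes modulo which \<open>a\<close> has order between 1 and
  \<open>n\<close>, so this one number collects the squarefree moduli of all small orders.\<close>

definition power_pred_prod :: "nat \<Rightarrow> nat \<Rightarrow> nat" where
  "power_pred_prod a n = (\<Prod>h=1..n. a ^ h - 1)"

lemma power_pred_prod_pos: "a \<ge> 2 \<Longrightarrow> power_pred_prod a n > 0"
  unfolding power_pred_prod_def using one_less_power[of a] by (intro prod_pos) auto

lemma power_pred_prod_le:
  assumes "a \<ge> 2"
  shows "power_pred_prod a n \<le> 2 ^ (a * n\<^sup>2)"
proof -
  have "power_pred_prod a n \<le> (\<Prod>h=1..n. a ^ n)"
    unfolding power_pred_prod_def
  proof (intro prod_mono conjI)
    fix h assume "h \<in> {1..n}"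
    then have "a ^ h \<le> a ^ n" using assms by (intro power_increasing) auto
    then show "a ^ h - 1 \<le> a ^ n" by linarith
  qed simp
  also have "\<dots> = a ^ (n\<^sup>2)" by (simp add: power2_eq_square power_mult)
  also have "\<dots> \<le> (2 ^ a) ^ (n\<^sup>2)"
    by (intro power_mono) (use less_exp[of a] in auto)
  finally show ?thesis by (simp add: power_mult)
qed

lemma coprime_power_pred:
  fixes a q :: nat
  assumes "q dvd a ^ h - 1" "a \<ge> 1" "h \<ge> 1"
  shows "coprime q a"
proof -
  have "coprime (a ^ h - 1) (a ^ h)" using assms by (intro coprime_diff_one_left_nat) simp
  then have "coprime q (a ^ h)" using assms(1) coprime_divisors[of q "a ^ h - 1" "a ^ h" "a ^ h"] by simp
  then show ?thesis using assms(3) by simp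
qed

text \<open>This covers \<open>d\<close> not coprime to \<open>a\<close> as well: the order is then
  0, and both sides hold only for \<open>h = 0\<close>.\<close>

lemma dvd_power_pred_iff:
  fixes a d :: nat
  assumes "a \<ge> 1"
  shows "d dvd a ^ h - 1 \<longleftrightarrow> ord d a dvd h"
proof -
  have "d dvd a ^ h - 1 \<longleftrightarrow> [a ^ h = 1] (mod d)"
    using assms by (subst cong_altdef_nat) auto
  then show ?thesis by (simp only: ord_divides)
qed

lemma prime_factors_power_pred_prod_iff:
  assumes "a \<ge> 2"
  shows "q \<in> prime_factors (power_pred_prod a n) \<longleftrightarrow> prime q \<and> (\<exists>h\<in>{1..n}. q dvd a ^ h - 1)"
proof -
  have "q \<in> prime_factors (power_pred_prod a n) \<longleftrightarrow> prime q \<and> q dvd power_pred_prod a n"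
    using power_pred_prod_pos[OF assms, of n] by (auto simp: in_prime_factors_iff)
  also have "\<dots> \<longleftrightarrow> prime q \<and> (\<exists>h\<in>{1..n}. q dvd a ^ h - 1)"
    unfolding power_pred_prod_def by (intro conj_cong refl prime_dvd_prod_iff) auto
  finally show ?thesis .
qed

text \<open>If \<Prod>T has order at most \<open>x\<close>, then all its primes divide
  \<open>power_pred_prod a x\<close>, whatever \<open>H\<close> is. The sum is therefore at most the
  totient ratio of that number. Its binary logarithm is at most \<open>a * x ^ 2\<close>, which is
  why \<epsilon> is halved at the start.\<close>

lemma sum_totient_weight_ord_le:
  assumes a: "a \<ge> 2" and \<epsilon>: "\<epsilon> > 0"
  obtains C where "C > 0"
    "\<And>H x. 1 \<le> x \<Longrightarrow>
       (\<Sum>T | T \<subseteq> prime_factors (power_pred_prod a H) \<and> ord (\<Prod>T) a \<le> x. totient_weight T) \<le> C * real x powr \<epsilon>"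
proof -
  obtain C where C: "C > 0"
    "\<And>n y. 1 \<le> y \<Longrightarrow> 0 < n \<Longrightarrow> n \<le> 2 ^ y \<Longrightarrow> totient_ratio n \<le> C * real y powr (\<epsilon> / 2)"
    using totient_ratio_le_powr[of "\<epsilon> / 2"] \<epsilon> by auto
  show ?thesis
  proof
    show "C * real a powr (\<epsilon> / 2) > 0" using C a by simp
    fix H x :: nat assume x: "1 \<le> x"
    let ?PF = "\<lambda>n. prime_factors (power_pred_prod a n)"
    have sub: "T \<subseteq> ?PF x" if T: "T \<subseteq> ?PF H" "ord (\<Prod>T) a \<le> x" for T
    proof
      fix q assume q: "q \<in> T"
      have fin: "finite T" using T by (auto intro: finite_subset)
      have "coprime (\<Prod>T) a"
      proof (intro prod_coprime_left)
        fix q assume "q \<in> T"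
        then have "\<exists>h\<in>{1..H}. q dvd a ^ h - 1" using T a by (auto simp: prime_factors_power_pred_prod_iff)
        then show "coprime q a" using coprime_power_pred a by fastforce
      qed
      then have "ord (\<Prod>T) a > 0" by simp
      moreover have "\<Prod>T dvd a ^ ord (\<Prod>T) a - 1" using a by (subst dvd_power_pred_iff) auto
      then have "q dvd a ^ ord (\<Prod>T) a - 1" using q fin by (meson dvd_prodI dvd_trans)
      ultimately show "q \<in> ?PF x" using T q a by (auto simp: prime_factors_power_pred_prod_iff Suc_le_eq)
    qed
    have "(\<Sum>T | T \<subseteq> ?PF H \<and> ord (\<Prod>T) a \<le> x. totient_weight T) \<le> (\<Sum>T\<in>Pow (?PF x). totient_weight T)"
      by (intro sum_mono2) (use sub in \<open>auto intro!: totient_weight_nonneg\<close>)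
    also have "\<dots> = totient_ratio (power_pred_prod a x)" by (rule totient_ratio_eq_sum[symmetric])
    also have "\<dots> \<le> C * real (a * x\<^sup>2) powr (\<epsilon> / 2)"
      using a x power_pred_prod_pos[OF a] power_pred_prod_le[OF a] by (intro C) auto
    also have "\<dots> = C * real a powr (\<epsilon> / 2) * real x powr \<epsilon>"
      using x by (simp add: powr_mult powr_powr flip: powr_numeral)
    finally show "(\<Sum>T | T \<subseteq> ?PF H \<and> ord (\<Prod>T) a \<le> x. totient_weight T)
        \<le> C * real a powr (\<epsilon> / 2) * real x powr \<epsilon>" .
  qed
qed

text \<open>The least \<open>i\<close> with \<open>e \<le> 2 ^ i\<close> works. The bound
  \<open>i \<le> H\<close> lets one finite dyadic sum serve all orders up to
  \<open>H\<close>.\<close>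

lemma exists_power_two_between:
  assumes "e \<ge> 1" "e \<le> H"
  shows "\<exists>i\<le>H. e \<le> 2 ^ i \<and> 2 ^ i \<le> 2 * (e::nat)"
proof -
  define i where "i = (LEAST i. e \<le> 2 ^ i)"
  have ex: "e \<le> 2 ^ e" using less_exp[of e] by simp
  have i: "e \<le> 2 ^ i" unfolding i_def using ex by (rule LeastI)
  have "i \<le> e" unfolding i_def using ex by (rule Least_le)
  moreover have "2 ^ i \<le> 2 * e"
  proof (cases i)
    case (Suc j)
    then have "\<not> e \<le> 2 ^ j" unfolding i_def by (metis lessI not_less_Least)
    then show ?thesis using Suc by simp
  qed (use assms in simp)
  ultimately show ?thesis using i assms by (intro exI[of _ i]) simp
qed

text \<open>The set \<open>T\<close> stands for the squarefree modulus \<open>\<Prod>T\<close>, and the weight is \<open>1 / \<phi> (\<Prod>T)\<close>; the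
  orders are summed dyadically.\<close>

lemma romanoff_sum_bounded:
  assumes a: "a \<ge> 2" and \<epsilon>: "\<epsilon> > 0"
  obtains C where "C > 0"
    "\<And>H. (\<Sum>T | T \<subseteq> prime_factors (power_pred_prod a H) \<and> 1 \<le> ord (\<Prod>T) a \<and> ord (\<Prod>T) a \<le> H.
        totient_weight T * real (ord (\<Prod>T) a) powr - \<epsilon>) \<le> C"
proof -
  obtain C where C: "C > 0"
    "\<And>H x. 1 \<le> x \<Longrightarrow>
       (\<Sum>T | T \<subseteq> prime_factors (power_pred_prod a H) \<and> ord (\<Prod>T) a \<le> x. totient_weight T) \<le> C * real x powr (\<epsilon> / 2)"
    using sum_totient_weight_ord_le[OF a, of "\<epsilon> / 2"] \<epsilon> by auto
  \<comment> \<open>The ratio of the final geometric series: up to order \<open>2 ^ i\<close> the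
    weights sum to at most a constant times \<open>(2 ^ i) powr (\<epsilon> / 2)\<close>, against a
    factor \<open>(2 ^ i) powr - \<epsilon>\<close>.\<close>
  define r where "r = 2 powr (- (\<epsilon> / 2))"
  have r: "0 < r" "r < 1" using \<epsilon> by (auto simp: r_def powr_less_one)
  show ?thesis
  proof
    show "C * 2 powr \<epsilon> * (1 / (1 - r)) > 0" using C r by simp
    fix H :: nat
    let ?PF = "prime_factors (power_pred_prod a H)" and ?o = "\<lambda>T. ord (\<Prod>T) a"
    let ?A = "{T. T \<subseteq> ?PF \<and> 1 \<le> ?o T \<and> ?o T \<le> H}"
    have finA: "finite ?A" by (rule finite_subset[of _ "Pow ?PF"]) auto
    have w: "totient_weight T \<ge> 0" if "T \<subseteq> ?PF" for T
      using that by (auto intro!: totient_weight_nonneg)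
    \<comment> \<open>At the scale chosen for an order \<open>e\<close> one has
      \<open>2 ^ i \<le> 2 * e\<close>; the factor \<open>2 powr \<epsilon>\<close> then makes
      \<open>b i\<close> at least \<open>e powr - \<epsilon>\<close>.\<close>
    define b where "b i = 2 powr \<epsilon> * real (2 ^ i) powr - \<epsilon>" for i :: nat
    have b: "b i \<ge> 0" for i by (simp add: b_def)
    have "(\<Sum>T\<in>?A. totient_weight T * real (?o T) powr - \<epsilon>)
      \<le> (\<Sum>T\<in>?A. totient_weight T * (\<Sum>i\<le>H. if ?o T \<le> 2 ^ i then b i else 0))"
    proof (intro sum_mono mult_left_mono)
      fix T assume T: "T \<in> ?A"
      then obtain i where i: "i \<le> H" "?o T \<le> 2 ^ i" "2 ^ i \<le> 2 * ?o T"
        using exists_power_two_between[of "?o T" H] by auto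
      have "real (2 ^ i) \<le> 2 * real (?o T)"
        using i(3) by (metis of_nat_le_iff of_nat_mult of_nat_numeral)
      then have "(2 * real (?o T)) powr - \<epsilon> \<le> real (2 ^ i) powr - \<epsilon>"
        using \<epsilon> by (intro powr_mono2') auto
      then have "2 powr \<epsilon> * (2 * real (?o T)) powr - \<epsilon> \<le> b i"
        unfolding b_def by (intro mult_left_mono) auto
      also have "2 powr \<epsilon> * (2 * real (?o T)) powr - \<epsilon> = real (?o T) powr - \<epsilon>"
        by (simp add: powr_mult powr_minus)
      also have "b i = (\<Sum>i\<in>{i}. if ?o T \<le> 2 ^ i then b i else 0)" using i by simp
      also have "\<dots> \<le> (\<Sum>i\<le>H. if ?o T \<le> 2 ^ i then b i else 0)"
        by (rule sum_mono2) (use i b in auto)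
      finally show "real (?o T) powr - \<epsilon> \<le> (\<Sum>i\<le>H. if ?o T \<le> 2 ^ i then b i else 0)" .
      show "totient_weight T \<ge> 0" using T w by auto
    qed
    also have "\<dots> = (\<Sum>i\<le>H. \<Sum>T\<in>?A. totient_weight T * (if ?o T \<le> 2 ^ i then b i else 0))"
      unfolding sum_distrib_left by (rule sum.swap)
    also have "\<dots> \<le> (\<Sum>i\<le>H. C * 2 powr \<epsilon> * r ^ i)"
    proof (rule sum_mono)
      fix i
      have "(\<Sum>T\<in>?A. totient_weight T * (if ?o T \<le> 2 ^ i then b i else 0))
        = (\<Sum>T\<in>?A. if ?o T \<le> 2 ^ i then b i * totient_weight T else 0)"
        by (intro sum.cong) auto
      also have "\<dots> = b i * (\<Sum>T | T \<in> ?A \<and> ?o T \<le> 2 ^ i. totient_weight T)"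
        using finA by (simp add: sum.inter_filter[symmetric] sum_distrib_left)
      also have "\<dots> \<le> b i * (\<Sum>T | T \<subseteq> ?PF \<and> ?o T \<le> 2 ^ i. totient_weight T)"
        by (intro mult_left_mono sum_mono2 b) (auto intro!: w)
      also have "\<dots> \<le> b i * (C * real (2 ^ i) powr (\<epsilon> / 2))"
        by (intro mult_left_mono C b) simp
      also have "\<dots> = C * 2 powr \<epsilon> * (real (2 ^ i) powr - \<epsilon> * real (2 ^ i) powr (\<epsilon> / 2))"
        by (simp add: b_def)
      also have "real (2 ^ i) powr - \<epsilon> * real (2 ^ i) powr (\<epsilon> / 2) = real (2 ^ i) powr (- (\<epsilon> / 2))"
        by (simp flip: powr_add)
      also have "\<dots> = r ^ i"
        by (simp add: r_def powr_power powr_realpow[symmetric] powr_powr mult.commute)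
      finally show "(\<Sum>T\<in>?A. totient_weight T * (if ?o T \<le> 2 ^ i then b i else 0)) \<le> C * 2 powr \<epsilon> * r ^ i" .
    qed
    also have "\<dots> = C * 2 powr \<epsilon> * (\<Sum>i\<le>H. r ^ i)" by (simp add: sum_distrib_left)
    also have "(\<Sum>i\<le>H. r ^ i) \<le> 1 / (1 - r)"
      using r by (simp add: sum_gp0 divide_right_mono)
    finally show "(\<Sum>T\<in>?A. totient_weight T * real (?o T) powr - \<epsilon>) \<le> C * 2 powr \<epsilon> * (1 / (1 - r))"
      using C by (simp add: mult_left_mono)
  qed
qed

section \<open>Polynomial congruences\<close>

lemma lead_coeff_synthetic_div:
  fixes g :: "'a::comm_ring_1 poly"
  assumes "degree g \<ge> 1"
  shows "lead_coeff (synthetic_div g c) = lead_coeff g"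
proof -
  obtain n where n: "degree g = Suc n" using assms by (cases "degree g") auto
  have "coeff (g + smult c (synthetic_div g c)) (Suc n) = coeff (synthetic_div g c) n"
    unfolding synthetic_div_correct by simp
  moreover have "coeff (synthetic_div g c) (Suc n) = 0"
    by (rule coeff_eq_0) (simp add: n degree_synthetic_div)
  ultimately show ?thesis using n by (simp add: degree_synthetic_div)
qed

text \<open>Dividing out one root at a time bounds the modulus by a product of differences of roots, so
  that roots modulo \<open>e\<close> are sparse also when \<open>e\<close> is not prime.\<close>

lemma poly_cong_many_roots:
  fixes g :: "int poly" and e K Y :: int
  assumes "finite X" "card X = degree g + 1"
    and "\<And>x. x \<in> X \<Longrightarrow> e dvd K * poly g x"
    and "\<And>x y. x \<in> X \<Longrightarrow> y \<in> X \<Longrightarrow> \<bar>x - y\<bar> \<le> Y" and "Y \<ge> 1"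
  shows "\<exists>D. D \<noteq> 0 \<and> \<bar>D\<bar> \<le> Y ^ ((degree g)\<^sup>2) \<and> e dvd K * D * lead_coeff g"
  using assms
proof (induction "degree g" arbitrary: g K X)
  case 0
  then obtain c where "g = [:c:]" by (metis degree_eq_zeroE)
  moreover obtain x where "x \<in> X" using 0 by (metis One_nat_def add_0 card_1_singletonE insertI1)
  ultimately show ?case using 0(4)[of x] by (intro exI[of _ 1]) auto
next
  case (Suc n)
  have "X \<noteq> {}" using Suc by auto
  then obtain x0 where x0: "x0 \<in> X" by auto
  define g1 where "g1 = synthetic_div g x0"
  define X1 where "X1 = X - {x0}"
  \<comment> \<open>The factor \<open>x - x0\<close> split off from \<open>g\<close> varies with
    \<open>x\<close>. Enlarging it to the product over all remaining roots gives a common multiplier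
    \<open>K * P\<close>, to which the induction hypothesis applies; the parameter \<open>K\<close>
    is there to carry it.\<close>
  define P where "P = (\<Prod>x\<in>X1. x - x0)"
  have deg: "degree g1 = n" using Suc(2) by (simp add: g1_def degree_synthetic_div)
  have lc: "lead_coeff g1 = lead_coeff g"
    unfolding g1_def by (rule lead_coeff_synthetic_div) (use Suc(2) in simp)
  have fin: "finite X1" using Suc by (simp add: X1_def)
  have card: "card X1 = Suc n" using Suc x0 by (simp add: X1_def)
  have g: "poly g x = (x - x0) * poly g1 x + poly g x0" for x
    using arg_cong[OF synthetic_div_correct'[of x0 g], of "\<lambda>p. poly p x"]
    by (simp add: g1_def algebra_simps)
  have dv: "e dvd K * P * poly g1 x" if "x \<in> X1" for x
  proof -
    have "e dvd K * poly g x - K * poly g x0" using Suc.prems(3) that x0 by (auto simp: X1_def)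
    also have "\<dots> = K * (x - x0) * poly g1 x" by (subst g) (simp add: algebra_simps)
    also have "\<dots> dvd K * (x - x0) * poly g1 x * (\<Prod>y\<in>X1 - {x}. y - x0)" by simp
    also have "\<dots> = K * P * poly g1 x"
      unfolding P_def using that fin by (subst prod.remove[of X1 x]) auto
    finally show ?thesis .
  qed
  have "\<exists>D. D \<noteq> 0 \<and> \<bar>D\<bar> \<le> Y ^ ((degree g1)\<^sup>2) \<and> e dvd K * P * D * lead_coeff g1"
  proof (rule Suc(1))
    show "\<And>x y. x \<in> X1 \<Longrightarrow> y \<in> X1 \<Longrightarrow> \<bar>x - y\<bar> \<le> Y" using Suc.prems(4) by (auto simp: X1_def)
  qed (use deg fin card dv Suc.prems in auto)
  then obtain D where D: "D \<noteq> 0" "\<bar>D\<bar> \<le> Y ^ (n\<^sup>2)" "e dvd K * P * D * lead_coeff g"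
    using deg lc by metis
  have "\<bar>P\<bar> = (\<Prod>x\<in>X1. \<bar>x - x0\<bar>)" unfolding P_def by (rule abs_prod)
  also have "\<dots> \<le> (\<Prod>x\<in>X1. Y)"
    using Suc.prems(4) x0 by (intro prod_mono) (auto simp: X1_def)
  also have "\<dots> = Y ^ Suc n" using card by simp
  finally have "\<bar>P * D\<bar> \<le> Y ^ Suc n * Y ^ (n\<^sup>2)"
    using D(2) Suc.prems(5) unfolding abs_mult by (intro mult_mono) auto
  also have "\<dots> = Y ^ (Suc n + n\<^sup>2)" by (simp add: power_add)
  also have "\<dots> \<le> Y ^ ((Suc n)\<^sup>2)"
    using Suc.prems(5) by (intro power_increasing) (auto simp: power2_eq_square)
  finally have "\<bar>P * D\<bar> \<le> Y ^ ((degree g)\<^sup>2)" using Suc(2) by simp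
  moreover have "P \<noteq> 0" unfolding P_def using fin by (auto simp: X1_def)
  ultimately show ?case using D by (intro exI[of _ "P * D"]) (auto simp: mult.assoc)
qed

text \<open>Otherwise \<open>degree f + 1\<close> roots in one window would make \<open>e\<close>
  divide a nonzero multiple of the leading coefficient that is smaller than
  \<open>e\<close>.\<close>

lemma card_poly_cong_block_le:
  fixes f :: "int poly" and e c :: int and u Y :: nat
  assumes d: "degree f \<ge> 1" and lc: "lead_coeff f > 0"
    and Y: "Y \<ge> 1" and e: "lead_coeff f * int Y ^ ((degree f)\<^sup>2) < e"
  shows "card {n\<in>{u..<u + Y}. e dvd poly f (int n) - c} \<le> degree f"
proof (rule ccontr)
  assume "\<not> ?thesis"
  then have "degree f + 1 \<le> card {n\<in>{u..<u + Y}. e dvd poly f (int n) - c}" by simp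
  from obtain_subset_with_card_n[OF this]
  obtain X where X: "X \<subseteq> {n\<in>{u..<u + Y}. e dvd poly f (int n) - c}" "card X = degree f + 1" "finite X"
    by blast
  define g where "g = f + [:-c:]"
  have dg: "degree g = degree f" using d unfolding g_def by (intro degree_add_eq_left) simp
  have lg: "lead_coeff g = lead_coeff f" using d unfolding dg by (auto simp: g_def coeff_pCons split: nat.split)
  have "\<exists>D. D \<noteq> 0 \<and> \<bar>D\<bar> \<le> int Y ^ ((degree g)\<^sup>2) \<and> e dvd 1 * D * lead_coeff g"
  proof (rule poly_cong_many_roots)
    show "finite (int ` X)" "card (int ` X) = degree g + 1" using X dg by (auto simp: card_image)
    show "e dvd 1 * poly g x" if "x \<in> int ` X" for x
      using that X by (auto simp: g_def)
    show "\<bar>x - y\<bar> \<le> int Y" if "x \<in> int ` X" "y \<in> int ` X" for x y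
    proof -
      have "u \<le> nat x" "nat x < u + Y" "u \<le> nat y" "nat y < u + Y" "x \<ge> 0" "y \<ge> 0" using that X by auto
      then show ?thesis by linarith
    qed
  qed (use Y in auto)
  then obtain D where D: "D \<noteq> 0" "\<bar>D\<bar> \<le> int Y ^ ((degree f)\<^sup>2)" "e dvd D * lead_coeff f"
    using dg lg by auto
  have "e \<le> \<bar>D * lead_coeff f\<bar>" using D lc by (intro zdvd_imp_le) auto
  also have "\<dots> = \<bar>D\<bar> * lead_coeff f" using lc by (simp add: abs_mult)
  also have "\<dots> \<le> int Y ^ ((degree f)\<^sup>2) * lead_coeff f" using D lc by (intro mult_right_mono) auto
  finally show False using e by (simp add: mult.commute)
qed

text \<open>The range from 0 to \<open>N\<close> is covered by \<open>N div Y + 1\<close> windows of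
  length \<open>Y\<close>.\<close>

lemma card_poly_cong_le:
  fixes f :: "int poly" and e c :: int and N Y :: nat
  assumes d: "degree f \<ge> 1" and lc: "lead_coeff f > 0"
    and Y: "Y \<ge> 1" and e: "lead_coeff f * int Y ^ ((degree f)\<^sup>2) < e"
  shows "card {n. n \<le> N \<and> e dvd poly f (int n) - c} \<le> degree f * (N div Y + 1)"
proof -
  have "{n. n \<le> N \<and> e dvd poly f (int n) - c}
    \<subseteq> (\<Union>i\<in>{..N div Y}. {n\<in>{i * Y..<i * Y + Y}. e dvd poly f (int n) - c})"
  proof
    fix n assume n: "n \<in> {n. n \<le> N \<and> e dvd poly f (int n) - c}"
    have "n div Y * Y \<le> n" "n < n div Y * Y + Y"
      using Y by (auto simp: dividend_less_div_times add.commute)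
    then show "n \<in> (\<Union>i\<in>{..N div Y}. {n\<in>{i * Y..<i * Y + Y}. e dvd poly f (int n) - c})"
      using n by (intro UN_I[of "n div Y"]) (auto intro: div_le_mono)
  qed
  then have "card {n. n \<le> N \<and> e dvd poly f (int n) - c}
    \<le> card (\<Union>i\<in>{..N div Y}. {n\<in>{i * Y..<i * Y + Y}. e dvd poly f (int n) - c})"
    by (intro card_mono) auto
  also have "\<dots> \<le> (\<Sum>i\<in>{..N div Y}. card {n\<in>{i * Y..<i * Y + Y}. e dvd poly f (int n) - c})"
    by (rule card_UN_le) simp
  also have "\<dots> \<le> (\<Sum>i\<in>{..N div Y}. degree f)"
    by (intro sum_mono card_poly_cong_block_le assms)
  finally show ?thesis by (simp add: mult.commute)
qed

section \<open>Chebyshev's lower bound\<close>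

text \<open>The numbers \<open>1 / ((n + 1) (n choose k))\<close> form Leibniz's harmonic triangle, in which the entry
  \<open>(n, k + 1)\<close> is the entry \<open>(n - 1, k)\<close> minus the entry \<open>(n, k)\<close>.\<close>

lemma Lcm_leibniz_Ints:
  assumes "k \<le> n" "n < N"
  shows "real (Lcm {1..N}) * (1 / (real (n + 1) * real (n choose k))) \<in> \<int>"
  using assms
proof (induction k arbitrary: n)
  case 0
  then have "n + 1 dvd Lcm {1..N}" by (intro dvd_Lcm) auto
  then obtain j where j: "Lcm {1..N} = (n + 1) * j" by (elim dvdE)
  have "real (Lcm {1..N}) * (1 / (real (n + 1) * real (n choose 0))) = real j"
    unfolding j by (simp only: of_nat_mult binomial_n_0 of_nat_1) simp
  then show ?case by simp
next
  case (Suc k)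
  then obtain m where n: "n = Suc m" by (cases n) auto
  have km: "k \<le> m" using Suc n by simp
  define b where "b = real (n choose k)"
  define c where "c = real (m choose k)"
  define d where "d = real (n choose Suc k)"
  have pos: "b > 0" "c > 0" "d > 0"
    unfolding b_def c_def d_def of_nat_0_less_iff zero_less_binomial_iff using km n by auto
  have "Suc m * (m choose k) = (Suc m choose Suc k) * Suc k" by (rule Suc_times_binomial_eq)
  then have "real (Suc m * (m choose k)) = real ((Suc m choose Suc k) * Suc k)" by (simp only:)
  then have e1: "real n * c = d * (real k + 1)" by (simp add: c_def d_def n algebra_simps)
  have "k \<le> n" using km n by simp
  have "(n - k) * (n choose k) = n * (m choose k)" using binomial_absorb_comp[of n k] n by simp
  then have "real ((n - k) * (n choose k)) = real (n * (m choose k))" by (simp only:)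
  then have e2: "d * (real k + 1) = b * (real n - real k)"
  proof -
    have "(real n - real k) * b = real n * c"
      using \<open>real ((n - k) * (n choose k)) = _\<close> \<open>k \<le> n\<close>
      by (simp add: b_def c_def of_nat_diff)
    then show ?thesis using e1 by (simp add: mult.commute)
  qed
  \<comment> \<open>Expressing both \<open>c\<close> and \<open>d\<close> through \<open>b\<close>
    reduces the recurrence of the triangle to field arithmetic.\<close>
  have ck: "c = b * (real n - real k) / real n" using e1 e2 n by (simp add: field_simps)
  have dk: "d = b * (real n - real k) / (real k + 1)" using e2 by (simp add: field_simps)
  have nk: "real n - real k > 0" using km n by simp
  have E: "1 / (real (n + 1) * d) = 1 / (real n * c) - 1 / (real (n + 1) * b)"
    unfolding ck dk using nk pos n by (simp add: divide_simps)
  have mn: "real (m + 1) = real n" by (simp add: n)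
  have "real (Lcm {1..N}) * (1 / (real (n + 1) * d))
    = real (Lcm {1..N}) * (1 / (real (m + 1) * c)) - real (Lcm {1..N}) * (1 / (real (n + 1) * b))"
    unfolding mn E by (rule right_diff_distrib)
  also have "\<dots> \<in> \<int>"
    unfolding b_def c_def
  proof (rule Ints_diff[OF Suc.IH[of m] Suc.IH[of n]])
    show "k \<le> m" by (rule km)
    show "m < N" "k \<le> n" "n < N" using Suc.prems n by linarith+
  qed
  finally show ?case by (simp only: d_def)
qed

text \<open>The least common multiple times the triangle entry is a positive integer, hence at least
  1.\<close>

lemma binomial_le_Lcm:
  assumes "k \<le> n"
  shows "(n + 1) * (n choose k) \<le> Lcm {1..n + 1}"
proof -
  let ?x = "real (Lcm {1..n + 1}) * (1 / (real (n + 1) * real (n choose k)))"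
  have L: "Lcm {1..n + 1} > 0" by (rule Nat.gr0I) (simp add: Lcm_0_iff)
  have "?x \<in> \<int>" using assms by (intro Lcm_leibniz_Ints) auto
  have c: "real (n choose k) > 0" using assms by simp
  then have "?x > 0" using L by (intro mult_pos_pos divide_pos_pos) auto
  have Ints_ge: "x \<ge> 1" if "x \<in> \<int>" "x > 0" for x :: real
    using that by (auto elim!: Ints_cases)
  have "?x \<ge> 1" by (rule Ints_ge) fact+
  have D: "D \<le> L" if "1 \<le> L * (1 / D)" "D > 0" for L D :: real
    using that by (simp add: le_divide_eq)
  have "real (n + 1) * real (n choose k) \<le> real (Lcm {1..n + 1})"
    by (rule D[OF \<open>?x \<ge> 1\<close>]) (use c in simp)
  then have "real ((n + 1) * (n choose k)) \<le> real (Lcm {1..n + 1})" by (simp only: of_nat_mult)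
  then show ?thesis by (simp only: of_nat_le_iff)
qed

text \<open>At the centre of row \<open>2 * m\<close> the triangle supplies a factor
  \<open>2 * m + 1\<close>, which absorbs the denominator in the lower bound
  \<open>4 ^ m / (2 * m)\<close> for the central binomial coefficient. For \<open>N < 3\<close> the
  truncated exponent is 0.\<close>

lemma power_two_le_Lcm: "2 ^ (N - 2) \<le> Lcm {1..N::nat}"
proof (cases "N \<ge> 3")
  case True
  define m where "m = (N - 1) div 2"
  have m: "m \<ge> 1" "2 * m + 1 \<le> N" "N - 2 \<le> 2 * m" using True by (auto simp: m_def)
  have L: "Lcm {1..N} > 0" by (rule Nat.gr0I) (simp add: Lcm_0_iff)
  have cb: "4 ^ m / (2 * real m) \<le> real (2 * m choose m)"
    using m by (intro central_binomial_lower_bound) simp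
  have "4 ^ m = 4 ^ m / (2 * real m) * (2 * real m)" using m by simp
  also have "\<dots> \<le> real (2 * m choose m) * (2 * real m)" using cb by (rule mult_right_mono) simp
  also have "\<dots> \<le> real (2 * m choose m) * (2 * real m + 1)" by (rule mult_left_mono) simp_all
  also have "\<dots> = real ((2 * m + 1) * (2 * m choose m))"
    unfolding of_nat_mult by (simp add: mult.commute)
  also have "\<dots> \<le> real (Lcm {1..2 * m + 1})"
    using binomial_le_Lcm[of m "2 * m"] by (simp only: of_nat_le_iff)
  also have "\<dots> \<le> real (Lcm {1..N})"
  proof -
    have "Lcm {1..2 * m + 1} dvd Lcm {1..N}" using m by (intro Lcm_subset) auto
    then have "Lcm {1..2 * m + 1} \<le> Lcm {1..N}" using L by (rule dvd_imp_le)
    then show ?thesis by (simp only: of_nat_le_iff)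
  qed
  finally have "4 ^ m \<le> real (Lcm {1..N})" .
  then have "real (4 ^ m) \<le> real (Lcm {1..N})" by simp
  then have "(4::nat) ^ m \<le> Lcm {1..N}" by (simp only: of_nat_le_iff)
  moreover have "2 ^ (N - 2) \<le> (2::nat) ^ (2 * m)" using m by (intro power_increasing) auto
  ultimately show ?thesis by (simp add: power_mult)
next
  case False
  have L: "Lcm {1..N} > 0" by (rule Nat.gr0I) (simp add: Lcm_0_iff)
  then show ?thesis using False by simp
qed

text \<open>The multiplicity of \<open>p\<close> in a least common multiple is the largest of the
  multiplicities, so \<open>p ^ k\<close> already divides one of the numbers up to
  \<open>N\<close>.\<close>

lemma prime_power_dvd_Lcm:
  fixes p :: nat
  assumes "prime p" "p ^ k dvd Lcm {1..N}" "k \<ge> 1"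
  shows "p ^ k \<le> N"
  using assms(2)
proof (induction N)
  case 0
  then show ?case using assms by (simp add: prime_gt_1_nat)
next
  case (Suc N)
  have L: "Lcm {1..N} \<noteq> 0" by (simp add: Lcm_0_iff)
  have eq: "Lcm {1..Suc N} = lcm (Suc N) (Lcm {1..N})" by (simp add: atLeastAtMostSuc_conv)
  have "k \<le> multiplicity p (lcm (Suc N) (Lcm {1..N}))"
    using Suc.prems assms L unfolding eq by (intro multiplicity_geI) (auto simp: lcm_eq_0_iff)
  also have "\<dots> = max (multiplicity p (Suc N)) (multiplicity p (Lcm {1..N}))"
    using L assms by (intro multiplicity_lcm) auto
  finally have "p ^ k dvd Suc N \<or> p ^ k dvd Lcm {1..N}"
    by (auto simp only: le_max_iff_disj intro: multiplicity_dvd')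
  then show ?case using Suc.IH dvd_imp_le[of "p ^ k" "Suc N"] by auto
qed

lemma Lcm_le_power_card_primes: "Lcm {1..N::nat} \<le> N ^ card {p. prime p \<and> p \<le> N}"
proof (cases "N = 0")
  case False
  let ?L = "Lcm {1..N}" and ?S = "{p. prime p \<and> p \<le> N}"
  have L: "?L > 0" by (rule Nat.gr0I) (simp add: Lcm_0_iff)
  have pp: "p ^ multiplicity p ?L \<le> N" if "p \<in> prime_factors ?L" for p
    using that by (intro prime_power_dvd_Lcm multiplicity_dvd) (auto simp: prime_factors_multiplicity Suc_le_eq)
  have sub: "prime_factors ?L \<subseteq> ?S"
    using prime_power_dvd_Lcm[of _ 1 N] by (auto simp: in_prime_factors_iff)
  have "?L = (\<Prod>p\<in>prime_factors ?L. p ^ multiplicity p ?L)" by (rule prime_factorization_nat[OF L])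
  also have "\<dots> \<le> (\<Prod>p\<in>prime_factors ?L. N)" using pp by (intro prod_mono) auto
  also have "\<dots> = N ^ card (prime_factors ?L)" by simp
  also have "\<dots> \<le> N ^ card ?S" using False by (intro power_increasing card_mono sub) auto
  finally show ?thesis .
next
  case True
  then have "{p. prime p \<and> p \<le> N} = {}" by auto
  then have card0: "card {p. prime p \<and> p \<le> N} = 0" by (simp only: card.empty)
  show ?thesis unfolding card0 using True by simp
qed

text \<open>The two bounds for the least common multiple are compared by logarithms. The constant
  reflects that \<open>N - 2\<close> is at least N / 2 for \<open>N \<ge> 4\<close>.\<close>

lemma card_primes_ge:
  assumes "N \<ge> 4"
  shows "real (card {p. prime p \<and> p \<le> N}) \<ge> ln 2 / 2 * (real N / ln (real N))"
proof -
  have "(2::nat) ^ (N - 2) \<le> N ^ card {p. prime p \<and> p \<le> N}"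
    using power_two_le_Lcm Lcm_le_power_card_primes by (rule order_trans)
  then have "real (2 ^ (N - 2)) \<le> real (N ^ card {p. prime p \<and> p \<le> N})" by (simp only: of_nat_le_iff)
  then have "ln (2 ^ (N - 2) :: real) \<le> ln (real N ^ card {p. prime p \<and> p \<le> N})"
    using assms by (subst ln_le_cancel_iff) auto
  then have "real (N - 2) * ln 2 \<le> real (card {p. prime p \<and> p \<le> N}) * ln (real N)"
    using assms by (simp add: ln_realpow)
  moreover have "real N / 2 * ln 2 \<le> real (N - 2) * ln 2" using assms by (intro mult_right_mono) auto
  ultimately have "real N / 2 * ln 2 \<le> real (card {p. prime p \<and> p \<le> N}) * ln (real N)" by linarith
  moreover have "ln (real N) > 0" using assms by simp
  ultimately show ?thesis by (simp add: field_simps)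
qed

section \<open>Primes in arithmetic progressions\<close>

text \<open>The sum is the multiplicity of \<open>q\<close> in \<open>fact N\<close>. Only multiples
  of \<open>q\<close> contribute; dividing them by \<open>q\<close> leaves \<open>N div q\<close>
  plus the same sum up to \<open>N div q\<close>, and by induction this is at most
  \<open>2 * (N div q)\<close>.\<close>

lemma sum_multiplicity_le:
  assumes "prime (q::nat)"
  shows "(\<Sum>i=1..N. multiplicity q i) \<le> N"
proof (induction N rule: less_induct)
  case (less N)
  show ?case
  proof (cases "N = 0")
    case False
    have q: "q \<ge> 2" using assms by (rule prime_ge_2_nat)
    let ?M = "N div q"
    have "(\<Sum>i=1..N. multiplicity q i) = (\<Sum>i\<in>(*) q ` {1..?M}. multiplicity q i)"
    proof (rule sum.mono_neutral_right)
      show "(*) q ` {1..?M} \<subseteq> {1..N}"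
        using q by (auto simp: less_eq_div_iff_mult_less_eq mult.commute Suc_le_eq)
      show "\<forall>i\<in>{1..N} - (*) q ` {1..?M}. multiplicity q i = 0"
      proof
        fix i assume i: "i \<in> {1..N} - (*) q ` {1..?M}"
        have "\<not> q dvd i"
        proof
          assume "q dvd i"
          then obtain j where j: "i = q * j" by (elim dvdE)
          then have "j \<in> {1..?M}" using i q by (auto simp: less_eq_div_iff_mult_less_eq mult.commute Suc_le_eq)
          then show False using i j by blast
        qed
        then show "multiplicity q i = 0" by (rule not_dvd_imp_multiplicity_0)
      qed
    qed simp
    also have "\<dots> = (\<Sum>j=1..?M. multiplicity q (q * j))"
      using q by (subst sum.reindex) (auto simp: inj_on_def)
    also have "\<dots> = (\<Sum>j=1..?M. Suc (multiplicity q j))"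
      using assms q by (intro sum.cong refl multiplicity_times_same) auto
    also have "\<dots> = (\<Sum>j=1..?M. multiplicity q j) + ?M" by (simp add: sum_Suc)
    also have "(\<Sum>j=1..?M. multiplicity q j) \<le> ?M" using False q by (intro less) simp
    also have "?M + ?M \<le> N"
    proof -
      have "?M \<le> N div 2" using q by (intro div_le_mono2) auto
      then show ?thesis by linarith
    qed
    finally show ?thesis by simp
  qed simp
qed

lemma multiplicity_fact_le:
  assumes "prime (q::nat)"
  shows "multiplicity q (fact N) \<le> N"
proof -
  have "multiplicity q (fact N :: nat) = (\<Sum>i=1..N. multiplicity q i)"
    unfolding fact_prod of_nat_id using assms
    by (subst prime_elem_multiplicity_prod_distrib) auto
  then show ?thesis using sum_multiplicity_le[OF assms] by simp
qed

text \<open>The part of \<open>fact N\<close> composed of primes dividing \<open>e\<close> is its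
  gcd with \<open>e ^ N\<close>: such a prime has multiplicity at most \<open>N\<close> in
  \<open>fact N\<close> and at least \<open>N\<close> in \<open>e ^ N\<close>.\<close>

lemma fact_split_coprime:
  assumes "e \<ge> 1"
  obtains u v :: nat where "fact N = u * v" "u \<le> e ^ N" "coprime v e"
proof -
  define u where "u = gcd (fact N) (e ^ N)"
  define v where "v = fact N div u"
  have uv: "fact N = u * v" by (simp add: u_def v_def)
  have pos: "u > 0" "v > 0" using uv by (metis fact_nonzero gr0I mult_0 mult_0_right)+
  have "coprime v e"
  proof (rule ccontr)
    assume "\<not> coprime v e"
    then have "gcd v e \<noteq> 1" unfolding coprime_iff_gcd_eq_1 .
    then obtain q where "prime q" "q dvd gcd v e" by (rule prime_factor_nat[THEN exE]) blast
    then have q: "prime q" "q dvd v" "q dvd e" by auto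
    have "multiplicity q u = min (multiplicity q (fact N)) (multiplicity q (e ^ N))"
      unfolding u_def using q assms by (intro multiplicity_gcd) auto
    also have "multiplicity q (e ^ N) = N * multiplicity q e"
      using q assms by (intro prime_elem_multiplicity_power_distrib) auto
    also have "min (multiplicity q (fact N)) (N * multiplicity q e) = multiplicity q (fact N)"
    proof -
      have "multiplicity q e \<ge> 1" using q assms by (intro multiplicity_geI) auto
      then have "N * 1 \<le> N * multiplicity q e" by (rule mult_left_mono) simp
      then show ?thesis using multiplicity_fact_le[OF q(1), of N] by linarith
    qed
    also have "multiplicity q (fact N :: nat) = multiplicity q u + multiplicity q v"
      unfolding uv using q pos by (intro prime_elem_multiplicity_mult_distrib) auto
    finally have "multiplicity q v = 0" by simp
    moreover have "multiplicity q v \<ge> 1" using q pos by (intro multiplicity_geI) auto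
    ultimately show False by simp
  qed
  moreover have "u \<le> e ^ N" unfolding u_def using assms by (intro dvd_imp_le) auto
  ultimately show ?thesis using that uv by blast
qed

text \<open>Modulo \<open>v\<close> the number \<open>e\<close> is invertible, so \<open>b\<close>
  is congruent to some \<open>e * t\<close>. The product becomes \<open>e ^ N\<close> times a
  product of \<open>N\<close> consecutive integers, which \<open>fact N\<close> divides.\<close>

lemma dvd_prod_arith_progression:
  fixes b e v N :: nat
  assumes "v dvd fact N" "coprime v e"
  shows "v dvd (\<Prod>j<N. b + e * j)"
proof -
  obtain x where x: "[e * x = Suc 0] (mod v)"
    using assms(2) cong_solve_coprime_nat[of e v] by (auto simp: coprime_commute)
  define t where "t = x * b"
  have "[e * x * b = Suc 0 * b] (mod v)" using x by (intro cong_mult) auto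
  then have t: "[b = e * t] (mod v)" by (simp add: t_def cong_sym mult.assoc)
  have "[(\<Prod>j<N. b + e * j) = (\<Prod>j<N. e * t + e * j)] (mod v)"
    by (intro cong_prod cong_add t) auto
  moreover have "v dvd (\<Prod>j<N. e * t + e * j)"
  proof -
    have "int (fact N) dvd int (\<Prod>j<N. t + j)"
      using fact_dvd_pochhammer[of N "int t"] by (simp add: pochhammer_prod lessThan_atLeast0)
    then have "fact N dvd (\<Prod>j<N. t + j)" by (simp only: int_dvd_int_iff)
    then have "v dvd (\<Prod>j<N. t + j)" using assms(1) by (rule dvd_trans[rotated])
    moreover have "(\<Prod>j<N. e * t + e * j) = e ^ N * (\<Prod>j<N. t + j)"
      by (simp add: prod.distrib flip: distrib_left)
    ultimately show ?thesis by simp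
  qed
  ultimately show ?thesis by (simp add: cong_dvd_iff)
qed

text \<open>Chebyshev's argument in a progression: away from the primes dividing \<open>e\<close>, the number
  \<open>b (b + e) \<dots> (b + (N - 1) e) / N!\<close> is an integer; it is at most \<open>e ^ N\<close> and divisible by
  every prime in the product.\<close>

lemma prod_primes_arith_progression_le:
  fixes b e N :: nat
  assumes e: "e \<ge> 2" and b: "b < e" "coprime b e"
  shows "(\<Prod>p | prime p \<and> N < p \<and> p < e * N \<and> p mod e = b. p) \<le> e ^ (2 * N)"
proof -
  let ?Q = "{p. prime p \<and> N < p \<and> p < e * N \<and> p mod e = b}"
  let ?g = "\<lambda>j. b + e * j"
  obtain u v :: nat where uv: "fact N = u * v" "u \<le> e ^ N" "coprime v e"
    using fact_split_coprime[of e N] e by auto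
  have b0: "b > 0" using e b by (cases "b = 0") auto
  have finQ: "finite ?Q" by (rule finite_subset[of _ "{..<e * N}"]) auto
  have v: "v dvd (\<Prod>j<N. ?g j)" using uv by (intro dvd_prod_arith_progression) auto
  have p: "?g (p div e) = p" if "p \<in> ?Q" for p using that by (auto simp: mult.commute)
  have inj: "inj_on (\<lambda>p. p div e) ?Q" by (rule inj_on_inverseI[of _ ?g]) (use p in blast)
  have "(\<Prod>p\<in>?Q. p) = (\<Prod>p\<in>?Q. ?g (p div e))" by (rule prod.cong) (use p in auto)
  also have "\<dots> = (\<Prod>j\<in>(\<lambda>p. p div e) ` ?Q. ?g j)" using inj by (subst prod.reindex) auto
  also have "\<dots> dvd (\<Prod>j<N. ?g j)"
    by (intro prod_dvd_prod_subset) (auto simp: less_mult_imp_div_less mult.commute)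
  finally have Q: "(\<Prod>p\<in>?Q. p) dvd (\<Prod>j<N. ?g j)" .
  \<comment> \<open>The primes in the product exceed \<open>N\<close>, so they are coprime to
    \<open>fact N\<close> and to its factor \<open>v\<close>; both can be divided out of the
    progression together.\<close>
  have "coprime (\<Prod>p\<in>?Q. p) (fact N :: nat)"
  proof (rule prod_coprime_left)
    fix p assume "p \<in> ?Q"
    then have "prime p" "\<not> p dvd fact N" by (auto simp: prime_dvd_fact_iff)
    then show "coprime p (fact N :: nat)" by (rule prime_imp_coprime)
  qed
  then have "coprime (\<Prod>p\<in>?Q. p) v" unfolding uv(1) by simp
  then have "(\<Prod>p\<in>?Q. p) * v dvd (\<Prod>j<N. ?g j)" using Q v by (intro divides_mult)
  then have "(\<Prod>p\<in>?Q. p) * v \<le> (\<Prod>j<N. ?g j)" using b0 by (intro dvd_imp_le prod_pos) auto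
  also have "\<dots> \<le> (\<Prod>j<N. e * Suc j)"
  proof (intro prod_mono conjI)
    show "?g j \<le> e * Suc j" for j using b(1) by simp
  qed simp
  also have "\<dots> = e ^ N * fact N"
    by (simp only: prod.distrib prod_constant card_atLeastLessThan diff_zero fact_prod_Suc lessThan_atLeast0 of_nat_id)
  \<comment> \<open>The part \<open>u\<close> of \<open>fact N\<close> is not cancelled, which costs
    the second factor \<open>e ^ N\<close>.\<close>
  also have "\<dots> \<le> e ^ N * (e ^ N * v)" unfolding uv(1) by (intro mult_left_mono mult_right_mono uv(2)) simp_all
  also have "\<dots> = e ^ (2 * N) * v" by (simp add: mult_2 power_add)
  finally have le: "(\<Prod>p\<in>?Q. p) * v \<le> e ^ (2 * N) * v" .
  have "u * v \<noteq> 0" unfolding uv(1)[symmetric] by simp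
  then have "v > 0" by simp
  with le show ?thesis by (rule mult_right_le_imp_le)
qed

text \<open>With \<open>N = X div e + 1\<close>, so that \<open>X < e * N\<close>, the product bound
  handles the primes above \<open>N\<close> and induction the others. Since
  \<open>e \<ge> 4\<close>, these parts give at most 2 N and 2 N + 1 times \<open>ln e\<close>, and
  N \<le> 2 X / e closes the induction with the constant 8.\<close>

lemma sum_ln_primes_arith_progression_le:
  fixes b e X :: nat
  assumes e: "e \<ge> 4" and b: "b < e" "coprime b e"
  shows "(\<Sum>p | prime p \<and> p \<le> X \<and> p mod e = b. ln (real p)) \<le> (8 * (real X / real e) + 1) * ln (real e)"
proof (induction X rule: less_induct)
  case (less X)
  have b0: "b > 0" using e b by (cases "b = 0") auto
  have lne: "ln (real e) > 0" using e by simp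
  show ?case
  proof (cases "X < e")
    case True
    have "(\<Sum>p | prime p \<and> p \<le> X \<and> p mod e = b. ln (real p)) \<le> (\<Sum>p\<in>{b}. ln (real p))"
      by (rule sum_mono2) (use True b0 in auto)
    also have "\<dots> \<le> 1 * ln (real e)" using b b0 by simp
    also have "\<dots> \<le> (8 * (real X / real e) + 1) * ln (real e)"
      using lne by (intro mult_right_mono) auto
    finally show ?thesis .
  next
    case False
    define N where "N = X div e + 1"
    let ?Q = "{p. prime p \<and> N < p \<and> p < e * N \<and> p mod e = b}"
    let ?R = "{p. prime p \<and> p \<le> N \<and> p mod e = b}"
    have "X div e \<le> X div 4" using e by (intro div_le_mono2) auto
    then have NX: "N < X" using False e by (simp add: N_def)
    have XN: "X < e * N" unfolding N_def using e dividend_less_times_div[of e X]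
      by (simp add: algebra_simps)
    have "real (X div e) \<le> real X / real e" by (rule of_nat_div_le_of_nat)
    moreover have "1 \<le> real X / real e" using False e by (simp add: le_divide_eq)
    ultimately have N: "real N \<le> 2 * (real X / real e)" by (simp add: N_def)
    have fQ: "finite ?Q" by (rule finite_subset[of _ "{..<e * N}"]) auto
    have "(\<Sum>p | prime p \<and> p \<le> X \<and> p mod e = b. ln (real p)) \<le> (\<Sum>p\<in>?R \<union> ?Q. ln (real p))"
      by (rule sum_mono2) (use fQ XN in \<open>auto dest: prime_gt_0_nat\<close>)
    also have "\<dots> = (\<Sum>p\<in>?R. ln (real p)) + (\<Sum>p\<in>?Q. ln (real p))"
      by (rule sum.union_disjoint) (use fQ in auto)
    also have "(\<Sum>p\<in>?R. ln (real p)) \<le> (8 * (real N / real e) + 1) * ln (real e)"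
      by (rule less[OF NX])
    also have "(\<Sum>p\<in>?Q. ln (real p)) = ln (real (\<Prod>p\<in>?Q. p))"
      unfolding of_nat_prod using fQ by (intro ln_prod[symmetric]) (auto simp: prime_gt_0_nat)
    also have "\<dots> \<le> ln (real (e ^ (2 * N)))"
    proof (subst ln_le_cancel_iff)
      show "real (\<Prod>p\<in>?Q. p) \<le> real (e ^ (2 * N))"
        using prod_primes_arith_progression_le[of e b N] e b by (simp only: of_nat_le_iff)
    qed (use e in \<open>auto intro!: prod_pos simp: prime_gt_0_nat\<close>)
    also have "\<dots> = 2 * real N * ln (real e)" using e by (simp add: ln_realpow)
    also have "(8 * (real N / real e) + 1) * ln (real e) + 2 * real N * ln (real e)
      = (8 * (real N / real e) + 1 + 2 * real N) * ln (real e)" by (simp add: algebra_simps)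
    also have "\<dots> \<le> (8 * (real X / real e) + 1) * ln (real e)"
    proof (rule mult_right_mono)
      have "real N / real e \<le> real N / 4" using e by (intro divide_left_mono) auto
      then show "8 * (real N / real e) + 1 + 2 * real N \<le> 8 * (real X / real e) + 1" using N by linarith
    qed (use lne in simp)
    finally show ?thesis by simp
  qed
qed

text \<open>The condition \<open>X < p\<^sup>2\<close> gives ln p \<ge> (ln X) / 2, which turns the
  weighted sum into a count. The additive 1 is absorbed by \<open>e \<le> X\<close>, whence 18 = 2 *
  9.\<close>

lemma card_primes_arith_progression_le:
  fixes b e X :: nat
  assumes e: "e \<ge> 4" "e \<le> X" and b: "b < e" "coprime b e"
  shows "real (card {p. prime p \<and> p \<le> X \<and> X < p\<^sup>2 \<and> p mod e = b})
    \<le> 18 * (real X / real e) * ln (real e) / ln (real X)"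
proof -
  let ?S = "{p. prime p \<and> p \<le> X \<and> X < p\<^sup>2 \<and> p mod e = b}"
  have lne: "ln (real e) > 0" and lnX: "ln (real X) > 0" using e by auto
  have "real (card ?S) * (ln (real X) / 2) = (\<Sum>p\<in>?S. ln (real X) / 2)" by simp
  also have "\<dots> \<le> (\<Sum>p\<in>?S. ln (real p))"
  proof (rule sum_mono)
    fix p assume p: "p \<in> ?S"
    then have "X \<le> p\<^sup>2" by simp
    then have "real X \<le> real (p\<^sup>2)" by (simp only: of_nat_le_iff)
    then have "ln (real X) \<le> ln ((real p)\<^sup>2)" using e p by (subst ln_le_cancel_iff) (auto simp: prime_gt_0_nat)
    also have "\<dots> = 2 * ln (real p)" using p by (simp add: ln_realpow prime_gt_0_nat)
    finally show "ln (real X) / 2 \<le> ln (real p)" by simp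
  qed
  also have "\<dots> \<le> (\<Sum>p | prime p \<and> p \<le> X \<and> p mod e = b. ln (real p))"
    by (rule sum_mono2) (auto dest: prime_gt_0_nat)
  also have "\<dots> \<le> (8 * (real X / real e) + 1) * ln (real e)"
    using e b by (intro sum_ln_primes_arith_progression_le) auto
  also have "\<dots> \<le> 9 * (real X / real e) * ln (real e)"
    using e lne by (intro mult_right_mono) (auto simp: field_simps)
  finally have "real (card ?S) * ln (real X) \<le> 18 * (real X / real e) * ln (real e)" by simp
  then show ?thesis using lnX by (simp only: pos_le_divide_eq)
qed

section \<open>Polynomial congruences in primes\<close>

lemma diff_dvd_poly_diff:
  fixes f :: "'a::comm_ring_1 poly"
  shows "x - y dvd poly f x - poly f y"
proof -
  have "poly f x = (x - y) * poly (synthetic_div f y) x + poly f y"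
    using arg_cong[OF synthetic_div_correct'[of y f], of "\<lambda>p. poly p x"]
    by (simp add: algebra_simps)
  then show ?thesis by simp
qed

text \<open>The window length is taken as large as the block bound permits. The parameter
  \<open>E\<close> may be chosen well below \<open>e\<close>, so that the first term still dominates
  the additive 1 when \<open>e\<close> is large compared with \<open>N\<close>.\<close>

lemma card_poly_cong_le_powr:
  fixes f :: "int poly"
  assumes d: "degree f \<ge> 1" and lc: "lead_coeff f > 0"
  defines "\<delta> \<equiv> 1 / real ((degree f)\<^sup>2)"
  obtains C where "C \<ge> 1"
    "\<And>N e E c. 1 \<le> E \<Longrightarrow> E \<le> real e \<Longrightarrow>
       real (card {n. n \<le> N \<and> int e dvd poly f (int n) - c}) \<le> C * (real N * E powr - \<delta> + 1)"
proof
  let ?\<kappa> = "(degree f)\<^sup>2"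
  define g where "g = real_of_int (lead_coeff f)"
  have g: "g \<ge> 1" using lc by (simp add: g_def)
  have \<delta>: "\<delta> > 0" using d by (simp add: \<delta>_def)
  define w where "w = (2 * g) powr \<delta>"
  have w: "w \<ge> 1" unfolding w_def using g \<delta> by (intro ge_one_powr_ge_zero) auto
  define C where "C = 2 * real (degree f) * w"
  have C: "C \<ge> real (degree f)" "C \<ge> 1" "C \<ge> w"
  proof -
    have "real (degree f) * 1 \<le> real (degree f) * w" using w by (intro mult_left_mono) auto
    moreover have "1 * w \<le> real (degree f) * w" using w d by (intro mult_right_mono) auto
    moreover have "real (degree f) \<ge> 1" using d by simp
    ultimately show "C \<ge> real (degree f)" "C \<ge> 1" "C \<ge> w" using w unfolding C_def by linarith+
  qed
  show "C + 1 \<ge> 1" using C by simp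
  fix N e :: nat and E :: real and c :: int
  assume E: "1 \<le> E" "E \<le> real e"
  let ?S = "{n. n \<le> N \<and> int e dvd poly f (int n) - c}"
  show "real (card ?S) \<le> (C + 1) * (real N * E powr - \<delta> + 1)"
  proof (cases "E < 2 * g")
    case True
    have "card ?S \<le> card {..N}" by (intro card_mono) auto
    then have "real (card ?S) \<le> real N * 1 + 1" by simp
    also have "\<dots> \<le> real N * (w * E powr - \<delta>) + 1"
    proof (intro add_mono mult_left_mono)
      have "E powr \<delta> \<le> w" unfolding w_def using E True \<delta> by (intro powr_mono2) auto
      then show "1 \<le> w * E powr - \<delta>" using E by (simp add: powr_minus field_simps)
    qed auto
    also have "\<dots> = w * (real N * E powr - \<delta>) + 1" by simp
    also have "\<dots> \<le> (C + 1) * (real N * E powr - \<delta>) + (C + 1) * 1"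
      using C by (intro add_mono mult_right_mono) auto
    finally show ?thesis by (simp add: algebra_simps)
  next
    case False
    \<comment> \<open>Chosen so that g y ^ (degree f)^2 = E / 2; the factor 2 makes the inequality
      required of the window length strict.\<close>
    define y where "y = (E / (2 * g)) powr \<delta>"
    have y: "y \<ge> 1" unfolding y_def using False g \<delta> by (intro ge_one_powr_ge_zero) auto
    define Y where "Y = nat \<lfloor>y\<rfloor>"
    have "\<lfloor>y\<rfloor> \<ge> 1" using y by simp
    moreover from this have "real Y = real_of_int \<lfloor>y\<rfloor>" by (simp add: Y_def)
    ultimately have Y: "Y \<ge> 1" "real Y \<le> y" "y \<le> 2 * real Y" by linarith+
    have "real Y ^ ?\<kappa> \<le> y ^ ?\<kappa>" using Y by (intro power_mono) auto
    also have "\<dots> = E / (2 * g)"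
      unfolding y_def \<delta>_def using E g d by (simp add: powr_power)
    finally have "g * real Y ^ ?\<kappa> \<le> g * (E / (2 * g))" using g by (intro mult_left_mono) auto
    also have "\<dots> < real e" using g E by simp
    finally have "real_of_int (lead_coeff f * int Y ^ ?\<kappa>) < real_of_int (int e)" by (simp add: g_def)
    then have "lead_coeff f * int Y ^ ?\<kappa> < int e" by (simp only: of_int_less_iff)
    then have "card ?S \<le> degree f * (N div Y + 1)" using d lc Y by (intro card_poly_cong_le) auto
    then have "real (card ?S) \<le> real (degree f * (N div Y + 1))" by (simp only: of_nat_le_iff)
    also have "\<dots> = real (degree f) * (real (N div Y) + 1)"
      by (simp only: of_nat_mult of_nat_add of_nat_1)
    also have "\<dots> \<le> real (degree f) * (real N / real Y + 1)"
      by (intro mult_left_mono add_mono of_nat_div_le_of_nat) auto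
    also have "\<dots> \<le> real (degree f) * (2 * (real N / y) + 1)"
    proof -
      have "real N / real Y \<le> real N * 2 / y"
        using Y y mult_left_mono[of y "2 * real Y" "real N"] by (simp add: divide_simps)
      then show ?thesis by (intro mult_left_mono) (auto simp: mult.commute)
    qed
    also have "real N / y = w * (real N * E powr - \<delta>)"
      unfolding y_def w_def using E g by (simp add: powr_divide powr_minus field_simps)
    also have "real (degree f) * (2 * (w * (real N * E powr - \<delta>)) + 1)
      = C * (real N * E powr - \<delta>) + real (degree f) * 1" by (simp add: C_def algebra_simps)
    also have "\<dots> \<le> (C + 1) * (real N * E powr - \<delta>) + (C + 1) * 1"
      using C by (intro add_mono mult_right_mono) auto
    finally show ?thesis by (simp add: algebra_simps)
  qed
qed

text \<open>Primes up to the square root of \<open>P\<close> are negligible. The others lie in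
  residue classes coprime to \<open>e\<close> that solve the congruence: there are at most a
  constant times e powr (1 - \<delta>) such classes, and each holds at most a constant times (P / e)
  (ln e / ln P) primes. Half of the exponent pays for ln e.\<close>

lemma card_primes_poly_cong_small:
  fixes f :: "int poly"
  assumes d: "degree f \<ge> 1" and lc: "lead_coeff f > 0"
  defines "\<delta> \<equiv> 1 / real ((degree f)\<^sup>2)"
  obtains C where "C > 0"
    "\<And>P e c. 4 \<le> e \<Longrightarrow> e ^ 4 \<le> P \<Longrightarrow>
       real (card {p. prime p \<and> p \<le> P \<and> int e dvd poly f (int p) - c})
         \<le> C * (real P / ln (real P)) * real e powr - (\<delta> / 2)"
proof -
  obtain C where C: "C \<ge> 1"
    "\<And>N e E c. 1 \<le> E \<Longrightarrow> E \<le> real e \<Longrightarrow>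
       real (card {n. n \<le> N \<and> int e dvd poly f (int n) - c}) \<le> C * (real N * E powr - \<delta> + 1)"
    using card_poly_cong_le_powr[OF d lc] unfolding \<delta>_def by blast
  have \<delta>: "\<delta> > 0" "\<delta> \<le> 1" using d by (auto simp: \<delta>_def)
  show ?thesis
  proof
    show "8 + 72 * C / \<delta> > 0" using C \<delta> by (simp add: add_pos_nonneg)
    fix P e :: nat and c :: int
    assume e: "4 \<le> e" and eP: "e ^ 4 \<le> P"
    let ?S = "{p. prime p \<and> p \<le> P \<and> int e dvd poly f (int p) - c}"
    let ?A = "{p. p\<^sup>2 \<le> P}"
    let ?R = "{b. b < e \<and> coprime b e \<and> int e dvd poly f (int b) - c}"
    let ?B = "\<lambda>b. {p. prime p \<and> p \<le> P \<and> P < p\<^sup>2 \<and> p mod e = b}"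
    have e1: "e \<le> e ^ 4" using e by (intro self_le_power) auto
    have P: "P \<ge> 4" "e \<le> P" using e e1 eP by linarith+
    have lnP: "ln (real P) > 0" using P by simp
    have A: "?A \<subseteq> {..P}"
    proof
      fix p assume "p \<in> ?A"
      then show "p \<in> {..P}" using self_le_power[of p 2] by (cases "p = 0") (auto simp: Suc_le_eq)
    qed
    have A': "real (card ?A) \<le> sqrt (real P) + 1"
    proof -
      have "?A \<subseteq> {..nat \<lfloor>sqrt (real P)\<rfloor>}"
      proof
        fix p assume "p \<in> ?A"
        then have "real (p\<^sup>2) \<le> real P" by (simp only: mem_Collect_eq of_nat_le_iff)
        then have "real p \<le> sqrt (real P)" by (intro real_le_rsqrt) simp
        then show "p \<in> {..nat \<lfloor>sqrt (real P)\<rfloor>}" by (simp add: le_nat_floor)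
      qed
      then have "card ?A \<le> card {..nat \<lfloor>sqrt (real P)\<rfloor>}" by (intro card_mono) auto
      then have "card ?A \<le> nat \<lfloor>sqrt (real P)\<rfloor> + 1" by simp
      then have "real (card ?A) \<le> real (nat \<lfloor>sqrt (real P)\<rfloor>) + 1"
        by (metis of_nat_1 of_nat_add of_nat_le_iff)
      moreover have "real (nat \<lfloor>sqrt (real P)\<rfloor>) \<le> sqrt (real P)" by (intro of_nat_floor) simp
      ultimately show ?thesis by linarith
    qed
    have "?S \<subseteq> ?A \<union> (\<Union>b\<in>?R. ?B b)"
    proof
      fix p assume p: "p \<in> ?S"
      show "p \<in> ?A \<union> (\<Union>b\<in>?R. ?B b)"
      proof (cases "p\<^sup>2 \<le> P")
        case False
        \<comment> \<open>Being larger than \<open>e\<close>, the prime \<open>p\<close> cannot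
          divide it, so its residue class is coprime to \<open>e\<close>.\<close>
        have "e < p"
        proof (rule ccontr)
          assume "\<not> e < p"
          then have "p\<^sup>2 \<le> e\<^sup>2" by (intro power_mono) auto
          also have "\<dots> \<le> e ^ 4" using e by (intro power_increasing) auto
          finally show False using False eP by simp
        qed
        then have "coprime p e" using p e by (intro prime_imp_coprime) (auto dest: dvd_imp_le)
        then have cop: "coprime (p mod e) e" using e by (simp add: coprime_mod_left_iff)
        have "int e dvd int p - int (p mod e)" by (simp add: of_nat_mod)
        also have "\<dots> dvd poly f (int p) - poly f (int (p mod e))" by (rule diff_dvd_poly_diff)
        finally have "int e dvd (poly f (int p) - c) - (poly f (int p) - poly f (int (p mod e)))"
          using p by (intro dvd_diff[of "int e" "poly f (int p) - c"]) simp_all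
        then have "p mod e \<in> ?R" using e cop by simp
        then show ?thesis using p False by (intro UnI2 UN_I[of "p mod e"]) auto
      qed simp
    qed
    then have "card ?S \<le> card (?A \<union> (\<Union>b\<in>?R. ?B b))"
      using finite_subset[OF A] by (intro card_mono) auto
    also have "\<dots> \<le> card ?A + card (\<Union>b\<in>?R. ?B b)" by (rule card_Un_le)
    also have "card (\<Union>b\<in>?R. ?B b) \<le> (\<Sum>b\<in>?R. card (?B b))" by (intro card_UN_le) auto
    finally have "real (card ?S) \<le> real (card ?A + (\<Sum>b\<in>?R. card (?B b)))"
      by (simp only: of_nat_le_iff add_left_mono)
    also have "\<dots> = real (card ?A) + (\<Sum>b\<in>?R. real (card (?B b)))" by simp
    also have "(\<Sum>b\<in>?R. real (card (?B b))) \<le> (\<Sum>b\<in>?R. 18 * (real P / real e) * ln (real e) / ln (real P))"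
      by (intro sum_mono card_primes_arith_progression_le) (use e P in auto)
    also have "\<dots> = real (card ?R) * (18 * (real P / real e) * ln (real e) / ln (real P))" by simp
    also have "\<dots> \<le> (2 * C * (real e * real e powr - \<delta>)) * (18 * (real P / real e) * ln (real e) / ln (real P))"
    proof (rule mult_right_mono)
      have "card ?R \<le> card {n. n \<le> e \<and> int e dvd poly f (int n) - c}" by (intro card_mono) auto
      then have "real (card ?R) \<le> real (card {n. n \<le> e \<and> int e dvd poly f (int n) - c})" by simp
      also have "\<dots> \<le> C * (real e * real e powr - \<delta> + 1)" using e by (intro C) auto
      also have "\<dots> \<le> C * (real e * real e powr - \<delta> + real e * real e powr - \<delta>)"
      proof (intro mult_left_mono add_mono)
        have "real e powr \<delta> \<le> real e powr 1" using \<delta> e by (intro powr_mono) auto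
        then show "1 \<le> real e * real e powr - \<delta>" using e by (simp add: powr_minus field_simps)
      qed (use C in auto)
      finally show "real (card ?R) \<le> 2 * C * (real e * real e powr - \<delta>)" by (simp add: algebra_simps)
    qed (use e lnP in auto)
    also have "\<dots> = 36 * C * (real P / ln (real P)) * (real e powr - \<delta> * ln (real e))"
      using e lnP by (simp add: field_simps)
    also have "\<dots> \<le> 36 * C * (real P / ln (real P)) * (2 / \<delta> * real e powr - (\<delta> / 2))"
    proof (rule mult_left_mono)
      have "ln (real e) \<le> real e powr (\<delta> / 2) / (\<delta> / 2)" using e \<delta> by (intro ln_powr_bound) auto
      then have "real e powr - \<delta> * ln (real e) \<le> real e powr - \<delta> * (real e powr (\<delta> / 2) / (\<delta> / 2))"
        by (intro mult_left_mono) auto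
      also have "\<dots> = 2 / \<delta> * (real e powr - \<delta> * real e powr (\<delta> / 2))" by simp
      also have "real e powr - \<delta> * real e powr (\<delta> / 2) = real e powr - (\<delta> / 2)"
        by (simp flip: powr_add)
      finally show "real e powr - \<delta> * ln (real e) \<le> 2 / \<delta> * real e powr - (\<delta> / 2)" .
    qed (use C lnP in auto)
    also have "real (card ?A) \<le> 8 * (real P / ln (real P)) * real e powr - (\<delta> / 2)"
    proof -
      \<comment> \<open>In terms of \<open>Q\<close> the three factors are bounded by 2 Q^2, 4 Q and
        Q, and their product is 8 P.\<close>
      define Q where "Q = real P powr (1 / 4)"
      have Q: "Q ^ 4 = real P" "Q \<ge> 1"
        using P unfolding Q_def by (auto simp: powr_power intro!: ge_one_powr_ge_zero)
      have "sqrt (real P) = Q\<^sup>2" by (rule real_sqrt_unique) (use Q in \<open>auto simp flip: power_mult\<close>)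
      moreover have "1 \<le> Q\<^sup>2" using Q by simp
      ultimately have "real (card ?A) \<le> 2 * Q\<^sup>2" using A' by linarith
      moreover have "ln (real P) \<le> 4 * Q"
        using ln_powr_bound[of "real P" "1 / 4"] P by (simp add: Q_def)
      moreover have "real e powr (\<delta> / 2) \<le> Q"
      proof -
        have "real e powr (\<delta> / 2) \<le> real e powr 1" using \<delta> e by (intro powr_mono) auto
        also have "real e powr 1 \<le> Q"
        proof -
          have "real (e ^ 4) \<le> real P" using eP by (simp only: of_nat_le_iff)
          then have "real e ^ 4 \<le> Q ^ 4" unfolding Q by simp
          then show ?thesis using Q(2) by (subst (asm) power_mono_iff) auto
        qed
        finally show ?thesis .
      qed
      ultimately have "real (card ?A) * ln (real P) * real e powr (\<delta> / 2) \<le> 2 * Q\<^sup>2 * (4 * Q) * Q"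
        using lnP Q by (intro mult_mono) auto
      also have "\<dots> = 8 * real P" by (simp add: Q(1)[symmetric] power2_eq_square power4_eq_xxxx)
      finally show ?thesis using lnP e by (simp add: powr_minus field_simps)
    qed
    finally show "real (card ?S) \<le> (8 + 72 * C / \<delta>) * (real P / ln (real P)) * real e powr - (\<delta> / 2)"
      by (simp add: algebra_simps)
  qed
qed

text \<open>Primality is dropped here: counting all integers up to \<open>P\<close> already saves a
  power of \<open>P\<close>. This outweighs ln P and, as \<open>e\<close> is polynomially bounded in
  \<open>P\<close>, also a small power of \<open>e\<close>.\<close>

lemma card_primes_poly_cong_large:
  fixes f :: "int poly"
  assumes d: "degree f \<ge> 1" and lc: "lead_coeff f > 0" and B: "B \<ge> 1"
  defines "\<delta> \<equiv> 1 / real ((degree f)\<^sup>2)"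
  obtains C where "C > 0"
    "\<And>P e c. 2 \<le> P \<Longrightarrow> P < e ^ 4 \<Longrightarrow> real e \<le> B * real P ^ degree f \<Longrightarrow>
       real (card {p. prime p \<and> p \<le> P \<and> int e dvd poly f (int p) - c})
         \<le> C * (real P / ln (real P)) * real e powr - (\<delta> / (8 * real (degree f)))"
proof -
  obtain C where C: "C \<ge> 1"
    "\<And>N e E c. 1 \<le> E \<Longrightarrow> E \<le> real e \<Longrightarrow>
       real (card {n. n \<le> N \<and> int e dvd poly f (int n) - c}) \<le> C * (real N * E powr - \<delta> + 1)"
    using card_poly_cong_le_powr[OF d lc] unfolding \<delta>_def by blast
  have \<delta>: "\<delta> > 0" "\<delta> \<le> 1" using d by (auto simp: \<delta>_def)
  define \<delta>' where "\<delta>' = \<delta> / (8 * real (degree f))"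
  have \<delta>': "\<delta>' > 0" "\<delta>' \<le> 1" using \<delta> d by (auto simp: \<delta>'_def divide_simps)
  show ?thesis
  proof
    show "16 * C * B / \<delta> > 0" using C B \<delta> by simp
    fix P e :: nat and c :: int
    assume P: "2 \<le> P" and e: "P < e ^ 4" "real e \<le> B * real P ^ degree f"
    let ?S = "{p. prime p \<and> p \<le> P \<and> int e dvd poly f (int p) - c}"
    \<comment> \<open>The choice E = P powr (1 / 4) saves \<open>Q\<^sup>2\<close>: one factor
      \<open>Q\<close> pays for ln P, the other for the power of \<open>e\<close>.\<close>
    define Q where "Q = real P powr (\<delta> / 8)"
    have Q: "Q \<ge> 1" unfolding Q_def using P \<delta> by (intro ge_one_powr_ge_zero) auto
    have lnP: "ln (real P) > 0" using P by simp
    have e0: "e > 0" using e(1) by (cases e) auto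
    define E where "E = real P powr (1 / 4)"
    have E: "E \<ge> 1" unfolding E_def using P by (intro ge_one_powr_ge_zero) auto
    have Ee: "E \<le> real e"
    proof -
      have "E ^ 4 = real P" using P by (simp add: E_def powr_power)
      also have "\<dots> \<le> real (e ^ 4)" using e(1) by (simp only: of_nat_le_iff less_imp_le)
      finally have "E ^ 4 \<le> real e ^ 4" by simp
      then show ?thesis using E by (simp add: power_mono_iff)
    qed
    have "card ?S \<le> card {n. n \<le> P \<and> int e dvd poly f (int n) - c}" by (intro card_mono) auto
    then have "real (card ?S) \<le> real (card {n. n \<le> P \<and> int e dvd poly f (int n) - c})" by simp
    also have "\<dots> \<le> C * (real P * E powr - \<delta> + 1)" using E Ee by (rule C(2))
    also have "\<dots> \<le> C * (real P * E powr - \<delta> + real P * E powr - \<delta>)"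
    proof (intro mult_left_mono add_mono)
      have "E powr \<delta> \<le> real P powr 1"
        unfolding E_def powr_powr using P \<delta> by (intro powr_mono) auto
      then show "1 \<le> real P * E powr - \<delta>" using P E by (simp add: powr_minus field_simps)
    qed (use C in auto)
    also have "\<dots> = 2 * C * (real P / Q\<^sup>2)"
      by (simp add: E_def Q_def powr_powr powr_power powr_minus divide_simps)
    finally have S: "real (card ?S) \<le> 2 * C * (real P / Q\<^sup>2)" .
    have ln: "ln (real P) \<le> 8 / \<delta> * Q"
      using ln_powr_bound[of "real P" "\<delta> / 8"] P \<delta> by (simp add: Q_def mult.commute)
    have "real e powr \<delta>' \<le> (B * real P ^ degree f) powr \<delta>'" using e \<delta>' by (intro powr_mono2) auto
    also have "\<dots> = B powr \<delta>' * Q"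
      using P B d by (simp add: powr_mult powr_powr Q_def \<delta>'_def flip: powr_realpow)
    also have "\<dots> \<le> B powr 1 * Q" using B \<delta>' Q by (intro mult_right_mono powr_mono) auto
    finally have e': "real e powr \<delta>' \<le> B * Q" using B by simp
    have "real (card ?S) * ln (real P) * real e powr \<delta>' \<le> 2 * C * (real P / Q\<^sup>2) * (8 / \<delta> * Q) * (B * Q)"
      using S ln e' C Q \<delta> lnP by (intro mult_mono) auto
    also have "\<dots> = 16 * C * B / \<delta> * real P" using Q by (simp add: power2_eq_square)
    finally have "real (card ?S) * ln (real P) * real e powr \<delta>' \<le> 16 * C * B / \<delta> * real P" .
    moreover have "s \<le> K * (real P / ln (real P)) * real e powr - \<delta>'"
      if "s * ln (real P) * real e powr \<delta>' \<le> K * real P" for s K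
      using lnP e0 that by (simp add: powr_minus field_simps)
    ultimately show "real (card ?S) \<le> 16 * C * B / \<delta> * (real P / ln (real P)) * real e powr - (\<delta> / (8 * real (degree f)))"
      unfolding \<delta>'_def by blast
  qed
qed

lemma card_primes_poly_cong_le:
  fixes f :: "int poly"
  assumes d: "degree f \<ge> 1" and lc: "lead_coeff f > 0" and B: "B \<ge> 1"
  obtains C \<delta> where "C > 0" "\<delta> > 0"
    "\<And>P e c. 4 \<le> P \<Longrightarrow> 1 \<le> e \<Longrightarrow> real e \<le> B * real P ^ degree f \<Longrightarrow>
       real (card {p. prime p \<and> p \<le> P \<and> int e dvd poly f (int p) - c})
         \<le> C * real (card {p. prime p \<and> p \<le> P}) * real e powr - \<delta>"
proof -
  define \<delta>0 where "\<delta>0 = 1 / real ((degree f)\<^sup>2)"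
  define \<delta> where "\<delta> = \<delta>0 / (8 * real (degree f))"
  have \<delta>0: "\<delta>0 > 0" "\<delta>0 \<le> 1" using d by (auto simp: \<delta>0_def)
  have \<delta>: "\<delta> > 0" "\<delta> \<le> \<delta>0 / 2" using \<delta>0 d by (auto simp: \<delta>_def divide_simps)
  obtain C1 where C1: "C1 > 0"
    "\<And>P e c. 4 \<le> e \<Longrightarrow> e ^ 4 \<le> P \<Longrightarrow>
       real (card {p. prime p \<and> p \<le> P \<and> int e dvd poly f (int p) - c})
         \<le> C1 * (real P / ln (real P)) * real e powr - (\<delta>0 / 2)"
    using card_primes_poly_cong_small[OF d lc] unfolding \<delta>0_def by blast
  obtain C2 where C2: "C2 > 0"
    "\<And>P e c. 2 \<le> P \<Longrightarrow> P < e ^ 4 \<Longrightarrow> real e \<le> B * real P ^ degree f \<Longrightarrow>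
       real (card {p. prime p \<and> p \<le> P \<and> int e dvd poly f (int p) - c})
         \<le> C2 * (real P / ln (real P)) * real e powr - \<delta>"
    using card_primes_poly_cong_large[OF d lc B] unfolding \<delta>0_def \<delta>_def by blast
  \<comment> \<open>Chebyshev's lower bound contributes \<open>2 / ln 2\<close>; the summand 4
    covers \<open>e < 4\<close>, where the trivial bound by the number of all primes is
    used.\<close>
  define C where "C = (C1 + C2) * (2 / ln 2) + 4"
  have C: "C > 0" "C \<ge> 4" using C1 C2 by (auto simp: C_def intro!: add_pos_pos mult_pos_pos)
  show ?thesis
  proof
    fix P e :: nat and c :: int
    assume P: "4 \<le> P" and e: "1 \<le> e" "real e \<le> B * real P ^ degree f"
    let ?S = "{p. prime p \<and> p \<le> P \<and> int e dvd poly f (int p) - c}"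
    let ?\<pi> = "real (card {p. prime p \<and> p \<le> P})"
    have lnP: "ln (real P) > 0" using P by simp
    have \<pi>: "real P / ln (real P) \<le> 2 / ln 2 * ?\<pi>"
    proof -
      have "2 / ln 2 * (ln 2 / 2 * (real P / ln (real P))) \<le> 2 / ln 2 * ?\<pi>"
        using card_primes_ge[OF P] by (intro mult_left_mono) auto
      then show ?thesis by simp
    qed
    have main: "real (card ?S) \<le> C * ?\<pi> * real e powr - \<delta>"
      if "real (card ?S) \<le> (C1 + C2) * (real P / ln (real P)) * real e powr - \<delta>"
    proof -
      note that
      also have "(C1 + C2) * (real P / ln (real P)) \<le> (C1 + C2) * (2 / ln 2 * ?\<pi>)"
        using \<pi> C1 C2 by (intro mult_left_mono) auto
      also have "\<dots> \<le> C * ?\<pi>" by (simp add: C_def algebra_simps)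
      finally show ?thesis by (simp add: mult_right_mono)
    qed
    show "real (card ?S) \<le> C * ?\<pi> * real e powr - \<delta>"
    proof (cases "e < 4")
      case True
      have "real e powr \<delta> \<le> 4 powr 1"
        by (intro powr_mono_both) (use e True \<delta> \<delta>0 in auto)
      then have "1 \<le> 4 * real e powr - \<delta>" using e by (simp add: powr_minus field_simps)
      also have "\<dots> \<le> C * real e powr - \<delta>" using C by (intro mult_right_mono) auto
      finally have "?\<pi> * 1 \<le> ?\<pi> * (C * real e powr - \<delta>)" by (intro mult_left_mono) auto
      moreover have "card ?S \<le> card {p. prime p \<and> p \<le> P}" by (intro card_mono) auto
      ultimately show ?thesis by (simp add: mult_ac)
    next
      case False
      show ?thesis
      proof (cases "e ^ 4 \<le> P")
        case True
        have "real (card ?S) \<le> C1 * (real P / ln (real P)) * real e powr - (\<delta>0 / 2)"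
          using False True by (intro C1) auto
        also have "\<dots> \<le> (C1 + C2) * (real P / ln (real P)) * real e powr - \<delta>"
          using C1 C2 lnP e \<delta> by (intro mult_mono powr_mono) auto
        finally show ?thesis by (rule main)
      next
        case False
        have "real (card ?S) \<le> C2 * (real P / ln (real P)) * real e powr - \<delta>"
          using False P e by (intro C2) auto
        also have "\<dots> \<le> (C1 + C2) * (real P / ln (real P)) * real e powr - \<delta>"
          using C1 C2 lnP by (intro mult_right_mono) auto
        finally show ?thesis by (rule main)
      qed
    qed
  qed (use C \<delta> in auto)
qed

section \<open>The average over pairs of primes\<close>

lemma poly_int_upper_bound:
  fixes f :: "int poly"
  obtains B :: real where "B \<ge> 2"
    "\<And>n. n \<ge> 1 \<Longrightarrow> real_of_int (poly f (int n)) \<le> B * real n ^ degree f"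
proof
  define B where "B = (\<Sum>i\<le>degree f. \<bar>coeff f i\<bar>)"
  have B: "B \<ge> 0" unfolding B_def by (intro sum_nonneg) auto
  \<comment> \<open>The added 2 ensures that the bound times ln a is at least 1 for every
    \<open>a \<ge> 2\<close>, as the choice of the cutoff requires.\<close>
  show "real_of_int (B + 2) \<ge> 2" using B by simp
  fix n :: nat assume n: "n \<ge> 1"
  have "poly f (int n) \<le> (\<Sum>i\<le>degree f. \<bar>coeff f i\<bar> * int n ^ degree f)"
    unfolding poly_altdef
  proof (intro sum_mono)
    fix i assume i: "i \<in> {..degree f}"
    have "coeff f i * int n ^ i \<le> \<bar>coeff f i\<bar> * int n ^ i" by (intro mult_right_mono) auto
    also have "\<dots> \<le> \<bar>coeff f i\<bar> * int n ^ degree f"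
      using i n by (intro mult_left_mono power_increasing) auto
    finally show "coeff f i * int n ^ i \<le> \<bar>coeff f i\<bar> * int n ^ degree f" .
  qed
  also have "\<dots> = B * int n ^ degree f" by (simp add: B_def sum_distrib_right)
  also have "\<dots> \<le> (B + 2) * int n ^ degree f" by (intro mult_right_mono) auto
  finally have "real_of_int (poly f (int n)) \<le> real_of_int ((B + 2) * int n ^ degree f)"
    by (simp only: of_int_le_iff)
  then show "real_of_int (poly f (int n)) \<le> real_of_int (B + 2) * real n ^ degree f" by simp
qed

lemma prod_dvd_of_subset_prime_factors:
  fixes n :: nat
  assumes "n > 0" "T \<subseteq> prime_factors n"
  shows "\<Prod>T dvd n"
proof -
  have "\<Prod>T dvd (\<Prod>p\<in>prime_factors n. p)" using assms by (intro prod_dvd_prod_subset) auto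
  also have "\<dots> dvd (\<Prod>p\<in>prime_factors n. p ^ multiplicity p n)"
  proof (rule prod_dvd_prod)
    fix p assume "p \<in> prime_factors n"
    then have "multiplicity p n \<noteq> 0" by (auto simp: prime_factors_multiplicity)
    then show "p dvd p ^ multiplicity p n" by (intro dvd_power) simp
  qed
  also have "\<dots> = n" using prime_factorization_nat[OF assms(1)] by simp
  finally show ?thesis .
qed

lemma totient_ratio_power_diff_le:
  fixes a i j :: nat
  assumes "a \<ge> 2" "j < i"
  shows "totient_ratio (a ^ i - a ^ j) \<le> totient_ratio a * totient_ratio (a ^ (i - j) - 1)"
proof -
  have "a ^ i - a ^ j = a ^ j * (a ^ (i - j) - 1)"
    using assms by (simp add: diff_mult_distrib2 flip: power_add)
  then have "totient_ratio (a ^ i - a ^ j) \<le> totient_ratio (a ^ j) * totient_ratio (a ^ (i - j) - 1)"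
    using totient_ratio_mult_le by metis
  also have "\<dots> \<le> totient_ratio a * totient_ratio (a ^ (i - j) - 1)"
    by (intro mult_right_mono totient_ratio_power_le less_imp_le totient_ratio_pos)
  finally show ?thesis .
qed

text \<open>For every squarefree divisor of \<open>a ^ h - 1\<close> the order of \<open>a\<close>
  divides \<open>h\<close>. The index set depends on \<open>H\<close> alone, so the sum can later be
  interchanged with a sum over \<open>h\<close>.\<close>

lemma totient_ratio_power_pred_le:
  assumes a: "a \<ge> 2" and h: "1 \<le> h" "h \<le> H"
  shows "totient_ratio (a ^ h - 1)
    \<le> (\<Sum>T | T \<subseteq> prime_factors (power_pred_prod a H) \<and> 1 \<le> ord (\<Prod>T) a \<and> ord (\<Prod>T) a \<le> H.
        if ord (\<Prod>T) a dvd h then totient_weight T else 0)"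
proof -
  let ?A = "{T. T \<subseteq> prime_factors (power_pred_prod a H) \<and> 1 \<le> ord (\<Prod>T) a \<and> ord (\<Prod>T) a \<le> H}"
  have fin: "finite ?A" by (rule finite_subset[of _ "Pow (prime_factors (power_pred_prod a H))"]) auto
  have pos: "a ^ h - 1 > 0" using one_less_power[of a h] a h by simp
  have "T \<in> ?A \<and> ord (\<Prod>T) a dvd h" if T: "T \<subseteq> prime_factors (a ^ h - 1)" for T
  proof -
    have "\<Prod>T dvd a ^ h - 1" using pos T by (rule prod_dvd_of_subset_prime_factors)
    then have dv: "ord (\<Prod>T) a dvd h" using a by (subst (asm) dvd_power_pred_iff) auto
    have "1 \<le> ord (\<Prod>T) a"
      using dv h by (metis One_nat_def Suc_leI dvd_0_left_iff gr0I not_one_le_zero)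
    moreover have "ord (\<Prod>T) a \<le> h" using dv h by (intro dvd_imp_le) auto
    moreover have "T \<subseteq> prime_factors (power_pred_prod a H)"
    proof
      fix q assume "q \<in> T"
      then have "prime q" "q dvd a ^ h - 1" using T by (auto simp: in_prime_factors_iff)
      then show "q \<in> prime_factors (power_pred_prod a H)"
        unfolding prime_factors_power_pred_prod_iff[OF a] using h by auto
    qed
    ultimately show ?thesis using dv h by simp
  qed
  then have "totient_ratio (a ^ h - 1) \<le> (\<Sum>T | T \<in> ?A \<and> ord (\<Prod>T) a dvd h. totient_weight T)"
    unfolding totient_ratio_eq_sum using fin
    by (intro sum_mono2) (auto intro!: totient_weight_nonneg)
  also have "\<dots> = (\<Sum>T\<in>?A. if ord (\<Prod>T) a dvd h then totient_weight T else 0)"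
    using fin by (rule sum.inter_filter)
  finally show ?thesis .
qed

text \<open>After splitting off a power of \<open>a\<close> and interchanging sums, each
  \<open>T\<close> is weighted by the number of pairs whose exponent difference is divisible by its
  order. Counting \<open>q\<close> for fixed \<open>p\<close> saves a power of the order, and
  Romanoff's series converges.\<close>

lemma sum_totient_ratio_power_diff_le:
  fixes f :: "int poly" and a :: nat
  assumes a: "a \<ge> 2" and d: "degree f \<ge> 1" and lc: "lead_coeff f > 0"
    and pos: "\<And>n::nat. n \<ge> 1 \<Longrightarrow> poly f (int n) > 0"
  defines "u \<equiv> \<lambda>p. nat (poly f (int p))"
  obtains C where "C > 0"
    "\<And>P S. 4 \<le> P \<Longrightarrow> S = {p. prime p \<and> p \<le> P} \<Longrightarrow>
       (\<Sum>(p, q) | p \<in> S \<and> q \<in> S \<and> u q < u p. totient_ratio (a ^ u p - a ^ u q)) \<le> C * (real (card S))\<^sup>2"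
proof -
  obtain B :: real where B: "B \<ge> 2"
    "\<And>n. n \<ge> 1 \<Longrightarrow> real_of_int (poly f (int n)) \<le> B * real n ^ degree f"
    by (rule poly_int_upper_bound[of f]) blast
  have B1: "B \<ge> 1" using B(1) by simp
  obtain C1 \<delta> where C1: "C1 > 0" "\<delta> > 0"
    "\<And>P e c. 4 \<le> P \<Longrightarrow> 1 \<le> e \<Longrightarrow> real e \<le> B * real P ^ degree f \<Longrightarrow>
       real (card {p. prime p \<and> p \<le> P \<and> int e dvd poly f (int p) - c})
         \<le> C1 * real (card {p. prime p \<and> p \<le> P}) * real e powr - \<delta>"
    by (rule card_primes_poly_cong_le[OF d lc B1]) blast
  obtain C2 where C2: "C2 > 0"
    "\<And>H. (\<Sum>T | T \<subseteq> prime_factors (power_pred_prod a H) \<and> 1 \<le> ord (\<Prod>T) a \<and> ord (\<Prod>T) a \<le> H.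
        totient_weight T * real (ord (\<Prod>T) a) powr - \<delta>) \<le> C2"
    by (rule romanoff_sum_bounded[OF a C1(2)]) blast
  show ?thesis
  proof
    show "totient_ratio a * C1 * C2 > 0" using C1 C2 totient_ratio_pos by simp
    fix P :: nat and S assume P: "4 \<le> P" and S: "S = {p. prime p \<and> p \<le> P}"
    have finS: "finite S" by (simp add: S)
    \<comment> \<open>This bounds all exponents \<open>u p\<close>, hence all differences and orders
      that occur, and keeps the orders in the range where the congruence bound applies.\<close>
    define H where "H = nat \<lfloor>B * real P ^ degree f\<rfloor>"
    let ?W = "{(p, q). p \<in> S \<and> q \<in> S \<and> u q < u p}"
    let ?A = "{T. T \<subseteq> prime_factors (power_pred_prod a H) \<and> 1 \<le> ord (\<Prod>T) a \<and> ord (\<Prod>T) a \<le> H}"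
    let ?o = "\<lambda>T. ord (\<Prod>T) a"
    have finA: "finite ?A" by (rule finite_subset[of _ "Pow (prime_factors (power_pred_prod a H))"]) auto
    have finW: "finite ?W" by (rule finite_subset[of _ "S \<times> S"]) (use finS in auto)
    have BP: "B * real P ^ degree f \<ge> 0" using B1 by simp
    have uH: "u p \<le> H" if "p \<in> S" for p
    proof -
      have p: "1 \<le> p" "p \<le> P" using that prime_ge_1_nat[of p] by (auto simp: S)
      have "real_of_int (poly f (int p)) \<le> B * real p ^ degree f" using p by (intro B)
      also have "\<dots> \<le> B * real P ^ degree f" using p B1 by (intro mult_left_mono power_mono) auto
      finally show ?thesis unfolding u_def H_def by (intro nat_mono) (simp add: le_floor_iff)
    qed
    have w: "totient_weight T \<ge> 0" if "T \<in> ?A" for T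
      using that by (auto intro!: totient_weight_nonneg)
    have "(\<Sum>(p, q)\<in>?W. totient_ratio (a ^ u p - a ^ u q))
      \<le> (\<Sum>(p, q)\<in>?W. totient_ratio a * (\<Sum>T\<in>?A. if ?o T dvd u p - u q then totient_weight T else 0))"
    proof (rule sum_mono)
      fix w assume "w \<in> ?W"
      then obtain p q where w: "w = (p, q)" and pq: "p \<in> S" "q \<in> S" "u q < u p" by auto
      have "totient_ratio (a ^ u p - a ^ u q) \<le> totient_ratio a * totient_ratio (a ^ (u p - u q) - 1)"
        using a pq by (intro totient_ratio_power_diff_le)
      also have "\<dots> \<le> totient_ratio a * (\<Sum>T\<in>?A. if ?o T dvd u p - u q then totient_weight T else 0)"
      proof (rule mult_left_mono)
        show "totient_ratio (a ^ (u p - u q) - 1) \<le> (\<Sum>T\<in>?A. if ?o T dvd u p - u q then totient_weight T else 0)"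
          using a pq uH[of p] by (intro totient_ratio_power_pred_le) auto
      qed (use totient_ratio_pos[of a] in simp)
      finally show "(case w of (p, q) \<Rightarrow> totient_ratio (a ^ u p - a ^ u q))
        \<le> (case w of (p, q) \<Rightarrow> totient_ratio a *
            (\<Sum>T\<in>?A. if ?o T dvd u p - u q then totient_weight T else 0))"
        by (simp only: w prod.case)
    qed
    also have "\<dots> = totient_ratio a * (\<Sum>W\<in>?W. \<Sum>T\<in>?A. if ?o T dvd u (fst W) - u (snd W) then totient_weight T else 0)"
      by (simp add: sum_distrib_left case_prod_unfold)
    also have "(\<Sum>W\<in>?W. \<Sum>T\<in>?A. if ?o T dvd u (fst W) - u (snd W) then totient_weight T else 0)
      = (\<Sum>T\<in>?A. \<Sum>W\<in>?W. if ?o T dvd u (fst W) - u (snd W) then totient_weight T else 0)"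
      by (rule sum.swap)
    also have "\<dots> = (\<Sum>T\<in>?A. totient_weight T * real (card {W\<in>?W. ?o T dvd u (fst W) - u (snd W)}))"
      using finW by (intro sum.cong refl) (simp flip: sum.inter_filter)
    also have "\<dots> \<le> (\<Sum>T\<in>?A. totient_weight T * (C1 * (real (card S))\<^sup>2 * real (?o T) powr - \<delta>))"
    proof (intro sum_mono mult_left_mono w)
      fix T assume T: "T \<in> ?A"
      let ?R = "\<lambda>p. {q. prime q \<and> q \<le> P \<and> int (?o T) dvd poly f (int q) - poly f (int p)}"
      have "{W\<in>?W. ?o T dvd u (fst W) - u (snd W)} \<subseteq> (SIGMA p:S. ?R p)"
      proof clarsimp
        fix p q assume pq: "p \<in> S" "q \<in> S" "u q < u p" "?o T dvd u p - u q"
        have "poly f (int p) > 0" "poly f (int q) > 0" using pq prime_ge_1_nat[of p] prime_ge_1_nat[of q]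
          by (auto intro!: pos simp: S)
        then have "int (u p - u q) = poly f (int p) - poly f (int q)" using pq(3) by (auto simp: u_def)
        moreover have "int (?o T) dvd int (u p - u q)" using pq(4) by (simp only: int_dvd_int_iff)
        ultimately have "int (?o T) dvd poly f (int q) - poly f (int p)" by (simp add: dvd_diff_commute)
        then show "prime q \<and> q \<le> P \<and> int (?o T) dvd poly f (int q) - poly f (int p)"
          using pq(2) by (simp add: S)
      qed
      then have "card {W\<in>?W. ?o T dvd u (fst W) - u (snd W)} \<le> card (SIGMA p:S. ?R p)"
        using finS by (intro card_mono finite_SigmaI) auto
      also have "\<dots> = (\<Sum>p\<in>S. card (?R p))" using finS by (intro card_SigmaI) auto
      finally have "real (card {W\<in>?W. ?o T dvd u (fst W) - u (snd W)}) \<le> (\<Sum>p\<in>S. real (card (?R p)))"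
        by (simp only: of_nat_le_iff flip: of_nat_sum)
      also have "\<dots> \<le> (\<Sum>p\<in>S. C1 * real (card S) * real (?o T) powr - \<delta>)"
      proof (rule sum_mono)
        fix p assume "p \<in> S"
        have "real (?o T) \<le> real H" using T by simp
        also have "\<dots> \<le> B * real P ^ degree f" unfolding H_def using BP by (rule of_nat_floor)
        finally show "real (card (?R p)) \<le> C1 * real (card S) * real (?o T) powr - \<delta>"
          unfolding S using P T by (intro C1) auto
      qed
      finally show "real (card {W\<in>?W. ?o T dvd u (fst W) - u (snd W)})
        \<le> C1 * (real (card S))\<^sup>2 * real (?o T) powr - \<delta>" by (simp add: power2_eq_square mult_ac)
    qed
    also have "\<dots> = C1 * (real (card S))\<^sup>2 * (\<Sum>T\<in>?A. totient_weight T * real (?o T) powr - \<delta>)"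
      by (simp add: sum_distrib_left mult_ac)
    also have "\<dots> \<le> C1 * (real (card S))\<^sup>2 * C2" using C1 by (intro mult_left_mono C2) auto
    finally show "(\<Sum>(p, q)\<in>?W. totient_ratio (a ^ u p - a ^ u q)) \<le> totient_ratio a * C1 * C2 * (real (card S))\<^sup>2"
      using totient_ratio_pos[of a] by (simp add: mult_left_mono mult_ac)
  qed
qed

section \<open>The second moment\<close>

text \<open>Values taken fewer than \<open>t\<close> times account for at most half of \<Omega>.
  Cauchy-Schwarz on the remaining values compares their number with the sum of squared
  multiplicities, which counts the coincidences of \<open>g\<close>.\<close>

lemma second_moment_card_ge:
  fixes g :: "'a \<Rightarrow> 'b" and t :: real
  assumes fin: "finite \<Omega>" "finite N" and gN: "g ` \<Omega> \<subseteq> N"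
    and t: "2 * t * real (card N) \<le> real (card \<Omega>)"
  shows "(real (card \<Omega>))\<^sup>2 \<le> 4 * real (card {n\<in>N. t \<le> real (card {\<omega>\<in>\<Omega>. g \<omega> = n})})
    * real (card {(\<omega>, \<omega>'). \<omega> \<in> \<Omega> \<and> \<omega>' \<in> \<Omega> \<and> g \<omega> = g \<omega>'})"
proof -
  define r where "r n = real (card {\<omega>\<in>\<Omega>. g \<omega> = n})" for n
  define G where "G = {n\<in>N. t \<le> r n}"
  let ?Q = "{(\<omega>, \<omega>'). \<omega> \<in> \<Omega> \<and> \<omega>' \<in> \<Omega> \<and> g \<omega> = g \<omega>'}"
  have finG: "finite G" "G \<subseteq> N" using fin by (auto simp: G_def)
  have "(\<Sum>n\<in>N. card {\<omega>\<in>\<Omega>. g \<omega> = n}) = (\<Sum>\<omega>\<in>\<Omega>. 1)"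
    using sum.group[OF fin gN, of "\<lambda>_. 1::nat"] by simp
  then have M: "(\<Sum>n\<in>N. r n) = real (card \<Omega>)" unfolding r_def by (simp flip: of_nat_sum)
  have "?Q = (SIGMA \<omega>:\<Omega>. {\<omega>'\<in>\<Omega>. g \<omega>' = g \<omega>})" by auto
  then have "card ?Q = (\<Sum>\<omega>\<in>\<Omega>. card {\<omega>'\<in>\<Omega>. g \<omega>' = g \<omega>})"
    using fin by (simp add: card_SigmaI)
  also have "\<dots> = (\<Sum>n\<in>N. \<Sum>\<omega> | \<omega> \<in> \<Omega> \<and> g \<omega> = n. card {\<omega>'\<in>\<Omega>. g \<omega>' = g \<omega>})"
    by (rule sum.group[OF fin gN, symmetric])
  also have "\<dots> = (\<Sum>n\<in>N. card {\<omega>\<in>\<Omega>. g \<omega> = n} * card {\<omega>\<in>\<Omega>. g \<omega> = n})"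
    by (intro sum.cong refl) simp
  finally have Q: "real (card ?Q) = (\<Sum>n\<in>N. (r n)\<^sup>2)"
    by (simp add: r_def power2_eq_square)

  have "(\<Sum>n\<in>N. r n) = (\<Sum>n\<in>N - G. r n) + (\<Sum>n\<in>G. r n)"
    using fin finG by (intro sum.subset_diff)
  moreover have "(\<Sum>n\<in>N - G. r n) \<le> real (card \<Omega>) / 2"
  proof (cases "t \<ge> 0")
    case True
    have "(\<Sum>n\<in>N - G. r n) \<le> (\<Sum>n\<in>N - G. t)" by (intro sum_mono) (auto simp: G_def)
    also have "\<dots> \<le> (\<Sum>n\<in>N. t)" using True fin by (intro sum_mono2) auto
    also have "\<dots> \<le> real (card \<Omega>) / 2" using t by (simp add: algebra_simps)
    finally show ?thesis .
  next
    case False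
    then have "G = N" by (auto simp: G_def r_def)
    then show ?thesis by simp
  qed
  ultimately have "real (card \<Omega>) / 2 \<le> (\<Sum>n\<in>G. r n)" using M by linarith
  then have "(real (card \<Omega>) / 2)\<^sup>2 \<le> (\<Sum>n\<in>G. r n)\<^sup>2" by (intro power_mono) auto
  also have "\<dots> \<le> (\<Sum>n\<in>G. (r n)\<^sup>2) * real (card G)" by (rule sum_squared_le_sum_of_squares)
  also have "\<dots> \<le> real (card ?Q) * real (card G)"
    unfolding Q using fin finG by (intro mult_right_mono sum_mono2) auto
  finally have "(real (card \<Omega>))\<^sup>2 \<le> 4 * real (card G) * real (card ?Q)"
    by (simp add: power_divide algebra_simps)
  then show ?thesis unfolding G_def r_def .
qed

section \<open>Fibres of the polynomial and terms of the sequence\<close>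

lemma finite_bounded_poly_args:
  fixes f :: "int poly"
  assumes "degree f \<ge> 1"
  shows "finite {p::nat. nat (poly f (int p)) \<le> n \<and> poly f (int p) > 0}"
proof -
  have "finite {p::nat. poly f (int p) = c}" for c
  proof -
    have "f - [:c:] \<noteq> 0" using assms by (metis degree_pCons_0 eq_iff_diff_eq_0 not_one_le_zero)
    then have "finite {x. poly (f - [:c:]) x = 0}" by (rule poly_roots_finite)
    then have "finite (int -` {x. poly (f - [:c:]) x = 0})" by (intro finite_vimageI) auto
    then show ?thesis by (simp add: vimage_def)
  qed
  then have "finite (\<Union>c\<in>{1..int n}. {p::nat. poly f (int p) = c})" by blast
  then show ?thesis by (rule rev_finite_subset) auto
qed

text \<open>As \<open>f\<close> need not be injective on the primes, several primes may give the
  same exponent; this bounds how many.\<close>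

lemma card_poly_fiber_le:
  fixes f :: "int poly"
  assumes "degree f \<ge> 1"
  shows "card {p::nat. p \<in> S \<and> poly f (int p) = c} \<le> degree f"
proof -
  have nz: "f - [:c:] \<noteq> 0" using assms by (metis degree_pCons_0 eq_iff_diff_eq_0 not_one_le_zero)
  have "card {p::nat. p \<in> S \<and> poly f (int p) = c} = card (int ` {p::nat. p \<in> S \<and> poly f (int p) = c})"
    by (simp add: card_image)
  also have "\<dots> \<le> card {x. poly (f - [:c:]) x = 0}"
    using poly_roots_finite[OF nz] by (intro card_mono) auto
  also have "\<dots> \<le> degree (f - [:c:])" using nz by (rule card_poly_roots_bound)
  also have "\<dots> \<le> degree f" by (intro degree_diff_le) auto
  finally show ?thesis .
qed

lemma pos_strict_seq_ge:
  assumes "pos_strict_seq A" "k \<ge> 1"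
  shows "k \<le> A k"
  using assms(2)
proof (induction k rule: dec_induct)
  case base
  then show ?case using assms(1) by (simp add: pos_strict_seq_def Suc_le_eq)
next
  case (step n)
  have "A n < A (Suc n)"
    using assms(1) step by (auto simp: pos_strict_seq_def strict_mono_on_def)
  then show ?case using step by simp
qed

lemma finite_seq_le:
  assumes "pos_strict_seq A"
  shows "finite {n. n \<ge> 1 \<and> real (A n) \<le> x}"
proof (rule finite_subset)
  show "{n. n \<ge> 1 \<and> real (A n) \<le> x} \<subseteq> {..nat \<lfloor>x\<rfloor>}"
  proof
    fix n assume "n \<in> {n. n \<ge> 1 \<and> real (A n) \<le> x}"
    then have "n \<ge> 1" "real (A n) \<le> x" by auto
    then have "real n \<le> x" using pos_strict_seq_ge[OF assms, of n] by linarith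
    then show "n \<in> {..nat \<lfloor>x\<rfloor>}" by (simp add: le_nat_floor)
  qed
qed simp

lemma inj_on_pos_strict_seq:
  assumes "pos_strict_seq A"
  shows "inj_on A {1..}"
  using assms unfolding pos_strict_seq_def by (auto intro: strict_mono_on_imp_inj_on)

text \<open>Coincidences \<open>a_k + v_p = a_l + v_q\<close>: those with \<open>v_p = v_q\<close> force \<open>k = l\<close>, the others are
  counted by the shifted sequence.\<close>

lemma card_coincidences_le:
  fixes v :: "nat \<Rightarrow> nat"
  assumes A: "pos_strict_seq A" and S: "finite S" and y: "y \<le> x"
    and D: "\<And>c. card {q\<in>S. v q = c} \<le> D"
  defines "K \<equiv> {k. k \<ge> 1 \<and> real (A k) \<le> y}" and "g \<equiv> \<lambda>(k, p). A k + v p"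
  shows "card {(\<omega>, \<omega>'). \<omega> \<in> K \<times> S \<and> \<omega>' \<in> K \<times> S \<and> g \<omega> = g \<omega>'}
    \<le> D * (card K * card S) + 2 * (\<Sum>(p, q) | p \<in> S \<and> q \<in> S \<and> v q < v p. shift_count A x (v p - v q))"
proof -
  let ?W = "{(p, q). p \<in> S \<and> q \<in> S \<and> v q < v p}"
  let ?Q = "{(\<omega>, \<omega>'). \<omega> \<in> K \<times> S \<and> \<omega>' \<in> K \<times> S \<and> g \<omega> = g \<omega>'}"
  let ?D = "SIGMA (k, p):K \<times> S. {q\<in>S. v q = v p}"
  let ?R = "\<lambda>(p, q). {k. k \<ge> 1 \<and> real (A k) \<le> x \<and> A k + (v p - v q) \<in> A ` {1..}}"
  let ?E = "SIGMA w:?W. ?R w"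
  let ?inv = "inv_into {1..} A"
  have finK: "finite K" unfolding K_def by (rule finite_seq_le[OF A])
  have finW: "finite ?W" by (rule finite_subset[of _ "S \<times> S"]) (use S in auto)
  have finR: "finite (?R w)" for w
    by (rule finite_subset[OF _ finite_seq_le[OF A, of x]]) (auto split: prod.splits)
  have inj: "inj_on A {1..}" by (rule inj_on_pos_strict_seq[OF A])
  \<comment> \<open>A coincidence is recovered from less data: \<open>?inv\<close> finds the second
    index from its term. The two orders of an off-diagonal pair are the images of one set under
    \<open>h1\<close> and \<open>h2\<close>, whence the factor 2.\<close>
  define h0 where "h0 = (\<lambda>((k::nat, p::nat), q::nat). ((k, p), (k, q)))"
  define h1 where "h1 = (\<lambda>((p, q), k). ((k, p), (?inv (A k + (v p - v q)), q)))"
  define h2 where "h2 = (\<lambda>((p, q), k). ((?inv (A k + (v p - v q)), q), (k, p)))"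
  have "?Q \<subseteq> h0 ` ?D \<union> (h1 ` ?E \<union> h2 ` ?E)"
  proof
    fix w assume "w \<in> ?Q"
    then obtain k p l q where w: "w = ((k, p), (l, q))" and kp: "k \<in> K" "p \<in> S"
      and lq: "l \<in> K" "q \<in> S" and eq: "g (k, p) = g (l, q)" by (cases w) auto
    have k: "k \<ge> 1" "real (A k) \<le> x" and l: "l \<ge> 1" "real (A l) \<le> x" using kp lq y by (auto simp: K_def)
    have eq: "A k + v p = A l + v q" using eq by (simp add: g_def)
    have inv: "?inv (A j) = j" if "j \<ge> 1" for j using inj that by (intro inv_into_f_f) auto
    consider "v p = v q" | "v q < v p" | "v p < v q" by linarith
    then show "w \<in> h0 ` ?D \<union> (h1 ` ?E \<union> h2 ` ?E)"
    proof cases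
      case 1
      then have "A k = A l" using eq by simp
      then have "k = l" using inj k l by (auto dest: inj_onD)
      then have "w \<in> h0 ` ?D"
        using kp lq 1 unfolding w by (intro image_eqI[of _ _ "((k, p), q)"]) (auto simp: h0_def)
      then show ?thesis by (rule UnI1)
    next
      case 2
      then have e: "A k + (v p - v q) = A l" using eq by linarith
      have "w \<in> h1 ` ?E"
        using kp lq 2 e k l inv[of l] unfolding w by (intro image_eqI[of _ _ "((p, q), k)"]) (auto simp: h1_def)
      then show ?thesis by (intro UnI2 UnI1)
    next
      case 3
      then have e: "A l + (v q - v p) = A k" using eq by linarith
      have "w \<in> h2 ` ?E"
        using kp lq 3 e k l inv[of k] unfolding w by (intro image_eqI[of _ _ "((q, p), l)"]) (auto simp: h2_def)
      then show ?thesis by (intro UnI2)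
    qed
  qed
  then have "card ?Q \<le> card (h0 ` ?D \<union> (h1 ` ?E \<union> h2 ` ?E))"
    using finK S finW finR by (intro card_mono finite_UnI finite_imageI finite_SigmaI) auto
  also have "\<dots> \<le> card (h0 ` ?D) + (card (h1 ` ?E) + card (h2 ` ?E))"
    by (intro order_trans[OF card_Un_le] add_mono card_Un_le order_refl)
  also have "\<dots> \<le> card ?D + (card ?E + card ?E)"
    using finK S finW finR by (intro add_mono card_image_le finite_SigmaI) auto
  also have "card ?E = (\<Sum>w\<in>?W. card (?R w))" using finW finR by (intro card_SigmaI) auto
  also have "\<dots> = (\<Sum>(p, q)\<in>?W. shift_count A x (v p - v q))"
    by (intro sum.cong) (auto simp: shift_count_def)
  also have "card ?D = (\<Sum>(k, p)\<in>K \<times> S. card {q\<in>S. v q = v p})"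
    using finK S by (subst card_SigmaI) (auto intro!: sum.cong)
  also have "\<dots> \<le> (\<Sum>(k, p)\<in>K \<times> S. D)" by (intro sum_mono) (use D in auto)
  finally show ?thesis by (simp add: card_cartesian_product mult_ac)
qed

text \<open>The cutoff is the integer part of the largest real \<open>y\<close> with \<kappa> y^d
  \<le> ln (x / 2). It has order (ln x) powr (1 / d) and ln P \<le> ln (ln x), so Chebyshev's bound
  gives the required number of primes.\<close>

lemma exists_prime_cutoff:
  fixes \<kappa> :: real and d :: nat
  assumes \<kappa>: "\<kappa> \<ge> 1" and d: "d \<ge> 1"
  obtains x0 c where "x0 \<ge> 4" "0 < c" "c \<le> 1"
    "\<And>x. x \<ge> x0 \<Longrightarrow> ln (ln x) > 0 \<and>
       (\<exists>P\<ge>4. \<kappa> * real P ^ d \<le> ln (x / 2) \<and>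
          c * (ln x powr (1 / real d) / ln (ln x)) \<le> real (card {p. prime p \<and> p \<le> P}))"
proof
  \<comment> \<open>The lower bound (ln x) / 2 for ln (x / 2) turns into
    \<open>b * L \<le> y\<close>. The threshold for \<open>x\<close> makes
    \<open>b * L \<ge> 8\<close>, which leaves room for rounding \<open>y\<close> down.\<close>
  define b where "b = (1 / (2 * \<kappa>)) powr (1 / real d)"
  have b: "b > 0" "b \<le> 1" unfolding b_def using \<kappa> d by (auto intro: powr_le1)
  show "exp ((8 / b) ^ d) + 4 \<ge> (4 :: real)" by simp
  have ln2: "ln 2 \<le> (1 :: real)" using ln_le_minus_one[of 2] by simp
  show "0 < ln 2 / 4 * b" using b by simp
  show "ln 2 / 4 * b \<le> 1" using b ln2 mult_mono[of "ln 2 / 4" 1 b 1] by simp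
  fix x :: real assume x: "x \<ge> exp ((8 / b) ^ d) + 4"
  define L where "L = ln x powr (1 / real d)"
  have x4: "x \<ge> 4" using x by (smt (verit) exp_gt_zero)
  have "(8 / b) ^ d \<le> ln x" using x x4 by (subst ln_ge_iff) auto
  moreover have "(8 / b) ^ d \<ge> 8"
  proof -
    have "8 / b \<ge> 8" using b by (simp add: field_simps)
    moreover have "8 / b \<le> (8 / b) ^ d" using d \<open>8 / b \<ge> 8\<close> by (intro self_le_power) auto
    ultimately show ?thesis by linarith
  qed
  ultimately have lnx: "ln x \<ge> 8" "(8 / b) ^ d \<le> ln x" by linarith+
  have lnlnx: "ln (ln x) > 0" using lnx by simp
  have "8 / b = ((8 / b) ^ d) powr (1 / real d)" using b d by (simp add: powr_powr flip: powr_realpow)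
  also have "\<dots> \<le> L" unfolding L_def using lnx b by (intro powr_mono2) auto
  finally have bL: "b * L \<ge> 8" using b by (simp add: field_simps)
  have half: "ln x / 2 \<le> ln (x / 2)"
  proof -
    have "2 * ln 2 \<le> ln x" using lnx ln2 by linarith
    then show ?thesis using x4 by (simp add: ln_div)
  qed
  define y where "y = (ln (x / 2) / \<kappa>) powr (1 / real d)"
  define P where "P = nat \<lfloor>y\<rfloor>"
  have "b * L = (ln x / 2 / \<kappa>) powr (1 / real d)"
    unfolding b_def L_def using \<kappa> lnx by (simp add: powr_mult[symmetric])
  also have "\<dots> \<le> y" unfolding y_def using \<kappa> half lnx by (intro powr_mono2 divide_right_mono) auto
  finally have y: "b * L \<le> y" .
  have P: "real P \<le> y" "y \<le> 2 * real P" "P \<ge> 4" using y bL unfolding P_def by linarith+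
  have "\<kappa> * real P ^ d \<le> \<kappa> * y ^ d" using \<kappa> P by (intro mult_left_mono power_mono) auto
  also have "y ^ d = ln (x / 2) / \<kappa>" unfolding y_def using d \<kappa> half lnx by (simp add: powr_power)
  also have "\<kappa> * (ln (x / 2) / \<kappa>) = ln (x / 2)" using \<kappa> by simp
  finally have 1: "\<kappa> * real P ^ d \<le> ln (x / 2)" .
  have "real P \<le> ln x"
  proof -
    have "real P ^ 1 \<le> real P ^ d" using d P by (intro power_increasing) auto
    also have "\<dots> \<le> \<kappa> * real P ^ d" using \<kappa> mult_right_mono[of 1 \<kappa> "real P ^ d"] by simp
    also have "\<dots> \<le> ln (x / 2)" by (rule 1)
    also have "\<dots> \<le> ln x" using x4 by simp
    finally show ?thesis by simp
  qed
  then have lnP: "ln (real P) \<le> ln (ln x)" "ln (real P) > 0" using P by simp_all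
  have "ln 2 / 4 * b * (L / ln (ln x)) = ln 2 / 2 * (b * L / 2 / ln (ln x))" by simp
  also have "\<dots> \<le> ln 2 / 2 * (real P / ln (real P))"
    using lnP y P bL by (intro mult_left_mono frac_le) auto
  also have "\<dots> \<le> real (card {p. prime p \<and> p \<le> P})" using P by (intro card_primes_ge)
  finally show "ln (ln x) > 0 \<and> (\<exists>P\<ge>4. \<kappa> * real P ^ d \<le> ln (x / 2) \<and>
      ln 2 / 4 * b * (ln x powr (1 / real d) / ln (ln x)) \<le> real (card {p. prime p \<and> p \<le> P}))"
    using 1 P lnlnx unfolding L_def by blast
qed

text \<open>With y = s / \<eta> the moment inequality bounds \<open>G\<close> below by a constant
  times x y / (1 + y). This increases with y, so a lower bound for \<open>s\<close> suffices;
  \<open>c \<le> 1\<close> allows \<open>c\<close> to be pulled out of the quotient.\<close>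

lemma moment_quotient_le:
  fixes G M Q x s \<eta> w :: real
  assumes "\<eta> > 0" "x > 0" "m > 0" "\<gamma> > 0" "0 < c" "c \<le> 1" "w > 0" "0 \<le> G"
    and M: "m * x * (s / \<eta>) \<le> M" and s: "c * w \<le> s"
    and Q: "Q \<le> \<gamma> * x * (s / \<eta>) * (1 + s / \<eta>)" and GQ: "M\<^sup>2 \<le> 4 * G * Q"
  shows "m\<^sup>2 * c / (4 * \<gamma>) * x * (w / (w + \<eta>)) \<le> G"
proof -
  define y where "y = s / \<eta>"
  define z where "z = c * w / \<eta>"
  have z: "z > 0" "z \<le> y" unfolding y_def z_def using assms by (auto intro: divide_right_mono)
  have "(m * x * y)\<^sup>2 \<le> M\<^sup>2" using M z assms unfolding y_def[symmetric] by (intro power_mono) auto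
  also have "\<dots> \<le> 4 * G * Q" by (rule GQ)
  also have "\<dots> \<le> 4 * G * (\<gamma> * x * y * (1 + y))" using Q assms unfolding y_def[symmetric] by (intro mult_left_mono) auto
  finally have "(x * y) * (m\<^sup>2 * x * y) \<le> (x * y) * (4 * \<gamma> * G * (1 + y))" by (simp add: power2_eq_square algebra_simps)
  then have le: "m\<^sup>2 * x * y \<le> 4 * \<gamma> * G * (1 + y)" using z assms by (simp only: mult_le_cancel_left_pos mult_pos_pos)
  have "c * (w / (w + \<eta>)) \<le> z / (1 + z)"
  proof -
    have "c * w / (w + \<eta>) \<le> c * w / (c * w + \<eta>)"
      using assms mult_right_mono[of c 1 w] by (intro divide_left_mono add_right_mono mult_pos_pos add_pos_pos) auto
    also have "\<dots> = z / (1 + z)" unfolding z_def using assms by (simp add: field_simps)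
    finally show ?thesis by simp
  qed
  also have "\<dots> \<le> y / (1 + y)" using z by (simp add: field_simps)
  finally have "m\<^sup>2 / (4 * \<gamma>) * x * (c * (w / (w + \<eta>))) \<le> m\<^sup>2 / (4 * \<gamma>) * x * (y / (1 + y))"
    using assms by (intro mult_left_mono) auto
  also have "\<dots> = m\<^sup>2 * x * y / (4 * \<gamma> * (1 + y))" by simp
  also have "\<dots> \<le> G" using le z assms by (subst pos_divide_le_eq) (auto simp: mult_ac)
  finally show ?thesis by (simp add: mult_ac)
qed

text \<open>Finiteness of the larger set is the essential point, since \<open>card\<close> is 0 on
  infinite sets. A representation of \<open>n\<close> bounds the index \<open>k\<close> and the
  exponent, and the exponent leaves finitely many \<open>p\<close>.\<close>

lemma card_le_rep_count:
  fixes f :: "int poly" and S K :: "nat set"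
  assumes a: "a \<ge> 2" and d: "degree f \<ge> 1" and A: "pos_strict_seq A"
    and pos: "\<And>n::nat. n \<ge> 1 \<Longrightarrow> poly f (int n) > 0"
    and S: "\<And>p. p \<in> S \<Longrightarrow> prime p" and K: "\<And>k. k \<in> K \<Longrightarrow> k \<ge> 1"
  shows "card {\<omega>\<in>K \<times> S. (\<lambda>(k, p). A k + a ^ nat (poly f (int p))) \<omega> = n} \<le> rep_count a f A n"
  unfolding rep_count_def
proof (rule card_mono)
  let ?R = "{(k, p). k \<ge> 1 \<and> prime p \<and> A k + a ^ nat (poly f (int p)) = n}"
  have "?R \<subseteq> {..n} \<times> {p::nat. nat (poly f (int p)) \<le> n \<and> poly f (int p) > 0}"
  proof clarsimp
    fix k p :: nat assume k: "Suc 0 \<le> k" and p: "prime p"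
    have "nat (poly f (int p)) < a ^ nat (poly f (int p))" using a by (intro power_gt_expt) simp
    then show "k \<le> A k + a ^ nat (poly f (int p)) \<and>
        nat (poly f (int p)) \<le> A k + a ^ nat (poly f (int p)) \<and> 0 < poly f (int p)"
      using pos_strict_seq_ge[OF A, of k] pos[of p] prime_ge_1_nat[OF p] k by simp
  qed
  then show "finite ?R"
    by (rule finite_subset) (intro finite_cartesian_product finite_atMost finite_bounded_poly_args[OF d])
  show "{\<omega>\<in>K \<times> S. (\<lambda>(k, p). A k + a ^ nat (poly f (int p))) \<omega> = n} \<subseteq> ?R"
    using S K by auto
qed

theorem theorem1p6:
  fixes a :: nat and f :: "int poly" and K1 K2 K3 K4 :: real
  assumes "a \<ge> 2"
    and "degree f \<ge> 1" and "lead_coeff f > 0" and "content f = 1"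
    and "\<forall>n::nat. n \<ge> 1 \<longrightarrow> poly f (int n) > 0"
    and "K1 > 0" and "K2 > 0" and "K3 > 0" and "K4 > 0"
  shows "\<exists>x0 c1 c2 :: real. x0 > 0 \<and> c1 > 0 \<and> c2 > 0 \<and>
    (\<forall>(\<eta> :: real \<Rightarrow> real) (A :: nat \<Rightarrow> nat).
       (\<forall>x\<ge>2. \<eta> x > 0) \<longrightarrow> pos_strict_seq A \<longrightarrow> admissible K1 K2 K3 K4 \<eta> A \<longrightarrow>
       (\<forall>x\<ge>x0.
          real (card {n::nat. n \<ge> 1 \<and> real n \<le> x \<and>
            real (rep_count a f A n) \<ge>
              c1 * (ln x powr (1 / real (degree f)) / (\<eta> x * ln (ln x)))})
          \<ge> c2 * x * (ln x powr (1 / real (degree f)) /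
              (ln x powr (1 / real (degree f)) + \<eta> x * ln (ln x)))))"
proof -
  define u where "u p = nat (poly f (int p))" for p :: nat
  define v where "v p = a ^ u p" for p
  have pos: "poly f (int n) > 0" if "n \<ge> 1" for n :: nat using assms(5) that by blast
  obtain B :: real where B: "B \<ge> 2"
    "\<And>n. n \<ge> 1 \<Longrightarrow> real_of_int (poly f (int n)) \<le> B * real n ^ degree f"
    by (rule poly_int_upper_bound[of f]) blast
  obtain C where C: "C > 0"
    "\<And>P S. 4 \<le> P \<Longrightarrow> S = {p. prime p \<and> p \<le> P} \<Longrightarrow>
       (\<Sum>(p, q) | p \<in> S \<and> q \<in> S \<and> u q < u p. totient_ratio (a ^ u p - a ^ u q)) \<le> C * (real (card S))\<^sup>2"
    using sum_totient_ratio_power_diff_le[OF assms(1-3) pos] unfolding u_def by blast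
  have lna: "ln (real a) \<ge> 1 / 2"
  proof -
    have "ln 2 \<le> ln (real a)" using assms(1) by simp
    then show ?thesis using ln_le_minus_one[of "1 / 2"] by (simp add: ln_div)
  qed
  \<comment> \<open>With this constant, \<open>\<kappa> * P ^ degree f \<le> ln (x / 2)\<close> says
    that \<open>a ^ u p \<le> x / 2\<close> for all primes up to \<open>P\<close>.\<close>
  define \<kappa> where "\<kappa> = B * ln (real a)"
  have \<kappa>: "\<kappa> \<ge> 1"
    using mult_mono[of 2 B "1 / 2" "ln (real a)"] B lna by (simp add: \<kappa>_def)
  obtain x0 c where c: "x0 \<ge> 4" "0 < c" "c \<le> 1" and cut:
    "\<And>x. x \<ge> x0 \<Longrightarrow> ln (ln x) > 0 \<and>
       (\<exists>P\<ge>4. \<kappa> * real P ^ degree f \<le> ln (x / 2) \<and>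
          c * (ln x powr (1 / real (degree f)) / ln (ln x)) \<le> real (card {p. prime p \<and> p \<le> P}))"
    by (rule exists_prime_cutoff[OF \<kappa> assms(2)]) blast
  \<comment> \<open>The first summand comes from coincidences with equal powers, the second from
    those counted by shifts.\<close>
  define \<gamma> where "\<gamma> = real (degree f) * K2 + 2 * K4 * C"
  have \<gamma>: "\<gamma> > 0" unfolding \<gamma>_def using assms C by (intro add_nonneg_pos) auto
  show ?thesis
  proof (intro exI conjI allI impI)
    show "x0 > 0" using c by simp
    \<comment> \<open>The first constant is half of a lower bound for the mean number of
      representations, in units of \<open>L / (\<eta> x * l)\<close>; the second is what the moment
      inequality yields with \<open>m = K1 * K3\<close>.\<close>
    show "K1 * K3 * c / 2 > 0" "(K1 * K3)\<^sup>2 * c / (4 * \<gamma>) > 0" using assms c \<gamma> by auto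
    fix \<eta> :: "real \<Rightarrow> real" and A :: "nat \<Rightarrow> nat" and x :: real
    assume \<eta>: "\<forall>x\<ge>2. \<eta> x > 0" and A: "pos_strict_seq A" and adm: "admissible K1 K2 K3 K4 \<eta> A"
      and x: "x \<ge> x0"
    have x2: "x \<ge> 2" "x > 0" using x c by auto
    have \<eta>x: "\<eta> x > 0" using \<eta> x2 by blast
    define L where "L = ln x powr (1 / real (degree f))"
    define l where "l = ln (ln x)"
    have l: "l > 0" using cut[OF x] by (simp add: l_def)
    have L: "L > 0" unfolding L_def using x c by simp
    obtain P where P: "P \<ge> 4" "\<kappa> * real P ^ degree f \<le> ln (x / 2)"
      and cP: "c * (L / l) \<le> real (card {p. prime p \<and> p \<le> P})"
      using cut[OF x] unfolding L_def l_def by blast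
    define S where "S = {p. prime p \<and> p \<le> P}"
    define s where "s = real (card S)"
    have finS: "finite S" by (simp add: S_def)
    have s: "c * (L / l) \<le> s" using cP by (simp add: s_def S_def)
    \<comment> \<open>Stopping at x / 2 keeps every sum with a power at most x / 2 within
      \<open>x\<close>; the hypothesis with \<open>K3\<close> shows that enough terms
      remain.\<close>
    define K where "K = {k. k \<ge> 1 \<and> real (A k) \<le> x / 2}"
    have finK: "finite K" unfolding K_def by (rule finite_seq_le[OF A])
    have S1: "p \<ge> 1" "prime p" if "p \<in> S" for p using that prime_ge_1_nat[of p] by (auto simp: S_def)
    define g where "g = (\<lambda>(k, p). A k + v p)"
    define N where "N = {n::nat. n \<ge> 1 \<and> real n \<le> x}"
    have N: "N \<subseteq> {1..nat \<lfloor>x\<rfloor>}" unfolding N_def by (auto simp: le_nat_floor)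
    have finN: "finite N" using N by (rule finite_subset) simp
    have cardN: "real (card N) \<le> x"
    proof -
      have "card N \<le> card {1..nat \<lfloor>x\<rfloor>}" using N by (intro card_mono) auto
      then have "real (card N) \<le> real (nat \<lfloor>x\<rfloor>)" by simp
      also have "\<dots> \<le> x" using x2 by (intro of_nat_floor) simp
      finally show ?thesis .
    qed
    have vx: "real (v p) \<le> x / 2" if p: "p \<in> S" for p
    proof -
      have "real (u p) = real_of_int (poly f (int p))" using pos[OF S1(1)[OF p]] by (simp add: u_def)
      also have "\<dots> \<le> B * real p ^ degree f" using S1(1)[OF p] by (rule B)
      also have "\<dots> \<le> B * real P ^ degree f" using p B by (intro mult_left_mono power_mono) (auto simp: S_def)
      finally have "real (u p) * ln (real a) \<le> B * real P ^ degree f * ln (real a)"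
        using lna by (intro mult_right_mono) auto
      also have "\<dots> \<le> ln (x / 2)" using P by (simp add: \<kappa>_def mult_ac)
      finally have "ln (real (v p)) \<le> ln (x / 2)" using assms(1) by (simp add: v_def ln_realpow)
      then show ?thesis using x2 assms(1) by (subst (asm) ln_le_cancel_iff) (auto simp: v_def)
    qed
    have gN: "g ` (K \<times> S) \<subseteq> N"
    proof
      fix n assume "n \<in> g ` (K \<times> S)"
      then obtain k p where n: "n = A k + v p" "k \<in> K" "p \<in> S" by (auto simp: g_def)
      have "v p \<ge> 1" unfolding v_def using assms(1) by simp
      then show "n \<in> N" using n vx[OF n(3)] by (auto simp: N_def K_def)
    qed
    have lt: "v q < v p \<longleftrightarrow> u q < u p" for p q unfolding v_def using assms(1) by simp
    define Q where "Q = card {(\<omega>, \<omega>'). \<omega> \<in> K \<times> S \<and> \<omega>' \<in> K \<times> S \<and> g \<omega> = g \<omega>'}"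
    \<comment> \<open>Half of the mean of the restricted representation numbers, taken over
      \<open>x\<close> values.\<close>
    define t where "t = real (card (K \<times> S)) / (2 * x)"
    define G where "G = {n\<in>N. t \<le> real (card {\<omega>\<in>K \<times> S. g \<omega> = n})}"
    have GQ: "(real (card (K \<times> S)))\<^sup>2 \<le> 4 * real (card G) * real Q"
      unfolding G_def Q_def
    proof (rule second_moment_card_ge[OF _ finN gN])
      have "2 * t * real (card N) \<le> 2 * t * x" using cardN x2 by (intro mult_left_mono) (auto simp: t_def)
      then show "2 * t * real (card N) \<le> real (card (K \<times> S))" using x2 by (simp add: t_def)
    qed (use finK finS in simp)
    have M: "K1 * K3 * x * (s / \<eta> x) \<le> real (card (K \<times> S))"
    proof -
      have "K3 * (K1 * x / \<eta> x) \<le> K3 * real (seq_count A x)"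
        using adm x2 assms(8) unfolding admissible_def by (intro mult_left_mono) auto
      also have "\<dots> \<le> real (seq_count A (x / 2))" using adm x2 unfolding admissible_def by auto
      also have "\<dots> = real (card K)" by (simp add: seq_count_def K_def)
      finally have "K3 * (K1 * x / \<eta> x) * s \<le> real (card K) * s" by (intro mult_right_mono) (auto simp: s_def)
      then show ?thesis by (simp add: s_def card_cartesian_product mult_ac)
    qed
    have KK: "real (card K) \<le> K2 * x / \<eta> x"
    proof -
      have "card K \<le> seq_count A x" unfolding K_def seq_count_def
        using x2 by (intro card_mono finite_seq_le[OF A]) auto
      then have "real (card K) \<le> real (seq_count A x)" by simp
      also have "\<dots> \<le> K2 * x / \<eta> x" using adm x2 unfolding admissible_def by auto
      finally show ?thesis .
    qed
    have Dv: "card {q\<in>S. v q = j} \<le> degree f" for j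
    proof (cases "\<exists>q0\<in>S. v q0 = j")
      case True
      then obtain q0 where q0: "q0 \<in> S" "v q0 = j" by blast
      have "{q\<in>S. v q = j} \<subseteq> {q. q \<in> S \<and> poly f (int q) = poly f (int q0)}"
      proof clarsimp
        fix q assume q: "q \<in> S" "j = v q"
        then have "u q = u q0" using q0 assms(1) by (simp add: v_def)
        then show "poly f (int q) = poly f (int q0)"
          using pos[OF S1(1)[OF q(1)]] pos[OF S1(1)[OF q0(1)]] by (simp add: u_def)
      qed
      then have "card {q\<in>S. v q = j} \<le> card {q. q \<in> S \<and> poly f (int q) = poly f (int q0)}"
        using finS by (intro card_mono) auto
      also have "\<dots> \<le> degree f" by (rule card_poly_fiber_le[OF assms(2)])
      finally show ?thesis .
    next
      case False
      then have "{q\<in>S. v q = j} = {}" by blast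
      then show ?thesis by (simp only: card.empty)
    qed
    let ?W = "{(p, q). p \<in> S \<and> q \<in> S \<and> v q < v p}"
    have "Q \<le> degree f * (card K * card S) + 2 * (\<Sum>(p, q)\<in>?W. shift_count A x (v p - v q))"
      unfolding Q_def g_def K_def using A finS Dv x2 by (intro card_coincidences_le) auto
    then have "real Q \<le> real (degree f * (card K * card S) + 2 * (\<Sum>(p, q)\<in>?W. shift_count A x (v p - v q)))"
      by (simp only: of_nat_le_iff)
    also have "\<dots> = real (degree f) * real (card K) * s + 2 * (\<Sum>w\<in>?W. real (shift_count A x (v (fst w) - v (snd w))))"
      by (simp add: s_def case_prod_unfold)
    also have "(\<Sum>w\<in>?W. real (shift_count A x (v (fst w) - v (snd w))))
      \<le> (\<Sum>w\<in>?W. K4 * (x / (\<eta> x)\<^sup>2) * totient_ratio (v (fst w) - v (snd w)))"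
    \<comment> \<open>The hypothesis on shifts is applied to the positive shift \<open>?r\<close>;
      its quotient by the totient becomes the ratio averaged earlier over pairs of primes.\<close>
    proof (rule sum_mono)
      fix w assume w: "w \<in> ?W"
      let ?r = "v (fst w) - v (snd w)"
      have r: "?r > 0" using w by auto
      have "real (shift_count A x ?r) \<le> K4 * (real ?r / real (totient ?r)) * (x / (\<eta> x)\<^sup>2)"
      proof -
        have "\<forall>r\<ge>1. real (shift_count A x r) \<le> K4 * (real r / real (totient r)) * (x / (\<eta> x)\<^sup>2)"
          using adm x2 unfolding admissible_def by blast
        moreover have "?r \<ge> 1" using r by linarith
        ultimately show ?thesis by blast
      qed
      then show "real (shift_count A x ?r) \<le> K4 * (x / (\<eta> x)\<^sup>2) * totient_ratio ?r"
        unfolding divide_totient[OF r] by (simp only: mult_ac)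
    qed
    also have "\<dots> = K4 * (x / (\<eta> x)\<^sup>2) * (\<Sum>(p, q) | p \<in> S \<and> q \<in> S \<and> u q < u p. totient_ratio (a ^ u p - a ^ u q))"
      unfolding sum_distrib_left[symmetric] lt by (simp add: v_def case_prod_unfold)
    also have "\<dots> \<le> K4 * (x / (\<eta> x)\<^sup>2) * (C * s\<^sup>2)"
      unfolding s_def using P S_def x2 assms(9) by (intro mult_left_mono C) auto
    also have "real (degree f) * real (card K) * s \<le> real (degree f) * (K2 * x / \<eta> x) * s"
      using KK by (intro mult_right_mono mult_left_mono) (auto simp: s_def)
    finally have "real Q \<le> real (degree f) * (K2 * x / \<eta> x) * s + 2 * (K4 * (x / (\<eta> x)\<^sup>2) * (C * s\<^sup>2))"
      by simp
    also have "\<dots> = x * (s / \<eta> x) * (real (degree f) * K2 + 2 * K4 * C * (s / \<eta> x))"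
      by (simp add: power2_eq_square algebra_simps)
    also have "\<dots> \<le> x * (s / \<eta> x) * (\<gamma> * (1 + s / \<eta> x))"
    proof (rule mult_left_mono)
      have "0 \<le> real (degree f) * K2 * (s / \<eta> x)" "0 \<le> 2 * K4 * C"
        using assms C \<eta>x by (auto simp: s_def)
      then show "real (degree f) * K2 + 2 * K4 * C * (s / \<eta> x) \<le> \<gamma> * (1 + s / \<eta> x)"
        unfolding \<gamma>_def by (simp add: algebra_simps)
    qed (use x2 \<eta>x in \<open>simp add: s_def\<close>)
    finally have Q: "real Q \<le> \<gamma> * x * (s / \<eta> x) * (1 + s / \<eta> x)" by (simp only: mult_ac)
    have main: "(K1 * K3)\<^sup>2 * c / (4 * \<gamma>) * x * (L / l / (L / l + \<eta> x)) \<le> real (card G)"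
      by (rule moment_quotient_le[OF _ _ _ _ _ _ _ _ M s Q GQ]) (use \<eta>x x2 assms c \<gamma> L l in auto)
    have eq: "L / l / (L / l + \<eta> x) = L / (L + \<eta> x * l)"
      using l L \<eta>x by (simp add: field_simps)
    have "G \<subseteq> {n. n \<ge> 1 \<and> real n \<le> x \<and>
        K1 * K3 * c / 2 * (L / (\<eta> x * l)) \<le> real (rep_count a f A n)}"
    proof
      fix n assume n: "n \<in> G"
      have "K1 * K3 * c / 2 * (L / (\<eta> x * l)) = K1 * K3 * x * (c * (L / l) / \<eta> x) / (2 * x)"
        using x2 l \<eta>x by (simp add: field_simps)
      also have "\<dots> \<le> K1 * K3 * x * (s / \<eta> x) / (2 * x)"
        using s x2 \<eta>x assms by (intro divide_right_mono mult_left_mono) auto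
      also have "\<dots> \<le> t" unfolding t_def using M x2 by (intro divide_right_mono) auto
      also have "t \<le> real (card {\<omega>\<in>K \<times> S. g \<omega> = n})" using n by (simp add: G_def)
      also have "\<dots> \<le> real (rep_count a f A n)"
        unfolding g_def v_def u_def of_nat_le_iff
        using assms(1,2) A pos S1(2) by (intro card_le_rep_count) (auto simp: K_def)
      finally show "n \<in> {n. n \<ge> 1 \<and> real n \<le> x \<and>
        K1 * K3 * c / 2 * (L / (\<eta> x * l)) \<le> real (rep_count a f A n)}"
        using n by (simp add: G_def N_def)
    qed
    then have "card G \<le> card {n. n \<ge> 1 \<and> real n \<le> x \<and>
        K1 * K3 * c / 2 * (L / (\<eta> x * l)) \<le> real (rep_count a f A n)}"
      by (intro card_mono finite_subset[OF _ finN]) (auto simp: N_def)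
    then have "real (card G) \<le> real (card {n. n \<ge> 1 \<and> real n \<le> x \<and>
        K1 * K3 * c / 2 * (L / (\<eta> x * l)) \<le> real (rep_count a f A n)})"
      by (simp only: of_nat_le_iff)
    with main show "(K1 * K3)\<^sup>2 * c / (4 * \<gamma>) * x * (ln x powr (1 / real (degree f)) /
        (ln x powr (1 / real (degree f)) + \<eta> x * ln (ln x)))
      \<le> real (card {n. n \<ge> 1 \<and> real n \<le> x \<and>
        K1 * K3 * c / 2 * (ln x powr (1 / real (degree f)) / (\<eta> x * ln (ln x))) \<le> real (rep_count a f A n)})"
      unfolding L_def[symmetric] l_def[symmetric] eq by (rule order_trans)
  qed
qed

end
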